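(* Let $N\ge1$, let $p\ge1$ be an integer, let $E\subset\mathfrak{SC}_p(\mathbb R^{2N},\mathbb R^N)$, let $\Theta$ and $\widehat\Theta$ be any pair of suitable sets of moduli of continuity, and let $D$ be any countable dense subset of $\mathbb R^N$. Then: (i) If $E$ has $L^p_{loc}$-bounded $l_2$-bounds and $\mathcal T_1,\mathcal T_2\in\{\mathcal T_{\Theta D},\mathcal T_{\Theta\widehat\Theta},\mathcal T_{\Theta B}\}$, then $$(E,\mathcal T_1)=(E,\mathcal T_2)\quad\text{and}\quad \mathrm{cls}_{(\mathfrak{SC}_p(\mathbb R^{2N},\mathbb R^N),\mathcal T_1)}(E)=\mathrm{cls}_{(\mathfrak{SC}_p(\mathbb R^{2N},\mathbb R^N),\mathcal T_2)}(E).$$ (ii) If $E$ has $L^1_{loc}$-bounded $l_2$-bounds and $\mathcal T_1,\mathcal T_2\in\{\sigma_{\Theta D},\sigma_{\Theta\widehat\Theta}\}$, then $$(E,\mathcal T_1)=(E,\mathcal T_2)\quad\text{and}\quad \mathrm{cls}_{(\mathfrak{SC}(\mathbb R^{2N},\mathbb R^N),\mathcal T_1)}(E)=\mathrm{cls}_{(\mathfrak{SC}(\mathbb R^{2N},\mathbb R^N),\mathcal T_2)}(E).$$ Here $(E,\mathcal T_1)=(E,\mathcal T_2)$ means that the two topologies induced on $E$ coincide, and $\mathrm{cls}$ denotes topological closure.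
   Context: $B_j$ is the closed ball of radius $j$ centered at the origin; $C(I,W)$ is the space of continuous functions $I\to W$. $L^p_{loc}$ is the set of real functions on $\mathbb R$ belonging to $L^p(I)$ for every compact interval $I$. $\mathfrak{SC}_p(\mathbb R^{2N},\mathbb R^N)$ is the set of functions $f:\mathbb R\times\mathbb R^{2N}\to\mathbb R^N$ such that: $f$ is Borel measurable; for every compact $K\subset\mathbb R^{2N}$ there is $m^K\in L^p_{loc}$ such that for a.e. $t\in\mathbb R$, $|f(t,z)|\le m^K(t)$ for all $z\in K$; and for a.e. $t\in\mathbb R$, $f(t,\cdot)$ is continuous. Functions differing only on a negligible set are identified. The subscript is omitted when $p=1$. Points of $\mathbb R^{2N}$ are written $(x,u)$ with $x,u\in\mathbb R^N$. The optimal $l_2$-bound of $f$ on $B_j\subset\mathbb R^{2N}$ is $l_2^j(t)=\sup|f(t,x,u_1)-f(t,x,u_2)|/|u_1-u_2|$ over $(x,u_1),(x,u_2)\in B_j$ with $u_1\ne u_2$. For $q\in\{1,p\}$, $E$ has $L^q_{loc}$-bounded $l_2$-bounds if for every $j\in\mathbb N$ the optimal $l_2$-bounds on $B_j$ of the elements of $E$ are in $L^p_{loc}$ and, for every $r>0$, $\sup_{f\in E}\int_{-r}^r l_{2,f}^j(t)^q\,dt<\infty$, where $l_{2,f}^j$ is the optimal $l_2$-bound of $f$ on $B_j$. A suitable set of moduli of continuity is a countable set $\Theta=\{\theta^I_j: j\in\mathbb N,\ I=[q_1,q_2],\ q_1,q_2\in\mathbb Q\}$ of non-decreasing continuous functions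 $[0,\infty)\to[0,\infty)$ with $\theta^I_j(0)=0$ and $\theta^{I_1}_{j_1}\le\theta^{I_2}_{j_2}$ whenever $I_1\subseteq I_2$, $j_1\le j_2$; similarly $\widehat\Theta=\{\hat\theta^I_j\}$. $\mathcal K^I_j$ (resp. $\widehat{\mathcal K}^I_j$) denotes the set of $x\in C(I,B_j)$, $B_j\subset\mathbb R^N$, with $|x(t)-x(s)|\le\theta^I_j(|t-s|)$ (resp. $\hat\theta^I_j(|t-s|)$) for all $t,s\in I$. Each topology is generated by the indicated seminorms, over all $I=[q_1,q_2]$ with rational endpoints and $j\in\mathbb N$ ($I-1$ denotes the translate of $I$). On $\mathfrak{SC}_p(\mathbb R^{2N},\mathbb R^N)$: - $\mathcal T_{\Theta D}$: $\sup_{x\in\mathcal K^I_j}[\int_I|f(t,x(t),u)|^pdt]^{1/p}$, $u\in D$; - $\mathcal T_{\Theta\widehat\Theta}$: $\sup_{x\in\mathcal K^I_j,\,u\in\widehat{\mathcal K}^{I-1}_j}[\int_I|f(t,x(t),u(t-1))|^pdt]^{1/p}$; - $\mathcal T_{\Theta B}$: $\sup_{x\in\mathcal K^I_j,\,u\in C(I-1,B_j)}[\int_I|f(t,x(t),u(t-1))|^pdt]^{1/p}$. On $\mathfrak{SC}(\mathbb R^{2N},\mathbb R^N)$: - $\sigma_{\Theta D}$: $\sup_{x\in\mathcal K^I_j}|\int_If(t,x(t),u)dt|$, $u\in D$; - $\sigma_{\Theta\widehat\Theta}$: $\sup_{x\in\mathcal K^I_j,\,u\in\widehat{\mathcal K}^{I-1}_j}|\int_If(t,x(t),u(t-1))dt|$.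 *)

theory Defs
  imports "HOL-Analysis.Analysis"
begin

text \<open>
  The space of N-dimensional vectors is \<open>real ^ 'n\<close> with N the cardinality of \<open>'n\<close> (so N is
  at least 1), and the 2N-dimensional space is the product \<open>(real ^ 'n) \<times> (real ^ 'n)\<close>, whose norm
  in the library is the Euclidean one.
\<close>

type_synonym 'n field = "real \<times> (real ^ 'n) \<times> (real ^ 'n) \<Rightarrow> real ^ 'n"

definition Lp_loc :: "nat \<Rightarrow> (real \<Rightarrow> real) set" where
  "Lp_loc p = {m. \<forall>a b. m \<in> borel_measurable (lebesgue_on {a..b}) \<and>
                        integrable (lebesgue_on {a..b}) (\<lambda>t. \<bar>m t\<bar> ^ p)}"

text \<open>Strong Caratheodory functions, before identification of a.e. equal functions.\<close>

definition SC_fun :: "nat \<Rightarrow> ('n::finite) field set" where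
  "SC_fun p = {f. f \<in> borel_measurable borel \<and>
     (\<forall>K. compact K \<longrightarrow>
        (\<exists>m\<in>Lp_loc p. AE t in lebesgue. \<forall>z\<in>K. norm (f (t, z)) \<le> m t)) \<and>
     (AE t in lebesgue. continuous_on UNIV (\<lambda>z. f (t, z)))}"

definition SC_eq :: "(('n::finite) field \<times> 'n field) set" where
  "SC_eq = {(f, g). f \<in> SC_fun 1 \<and> g \<in> SC_fun 1 \<and> (AE w in lebesgue. f w = g w)}"

text \<open>
  The space of strong Caratheodory functions consists of the classes of \<open>SC_eq\<close>. Every class is
  taken within \<open>SC_fun 1\<close>, so that for p at least 1 the space with exponent p is literally a subset
  of the space with exponent 1. This does not enlarge the classes: if \<open>f\<close> and \<open>g\<close> are related by
  \<open>SC_eq\<close>, then by Fubini and continuity the functions \<open>f (t, \<cdot>)\<close> and \<open>g (t, \<cdot>)\<close> coincide for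
  almost every t.
\<close>

definition SC :: "nat \<Rightarrow> ('n::finite) field set set" where
  "SC p = SC_fun p // SC_eq"

text \<open>
  The optimal bound takes values in the extended nonnegative reals, since the supremum can be
  infinite.
\<close>

definition l2_bound :: "('n::finite) field \<Rightarrow> nat \<Rightarrow> real \<Rightarrow> ennreal" where
  "l2_bound f j t =
     (SUP (x, u1, u2) \<in> {(x, u1, u2). (x, u1) \<in> cball 0 (real j) \<and> (x, u2) \<in> cball 0 (real j) \<and> u1 \<noteq> u2}.
        ennreal (norm (f (t, x, u1) - f (t, x, u2)) / norm (u1 - u2)))"

text \<open>
  The property of having \<open>L\<^sup>q\<close>-locally bounded \<open>l\<^sub>2\<close>-bounds, for a set of classes of exponent p.
  Changing the representative changes \<open>l2_bound\<close> only on a null set of times.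
\<close>

definition bounded_l2_bounds :: "nat \<Rightarrow> nat \<Rightarrow> ('n::finite) field set set \<Rightarrow> bool" where
  "bounded_l2_bounds p q E \<longleftrightarrow>
     (\<forall>j. (\<forall>f\<in>\<Union>E. (AE t in lebesgue. l2_bound f j t < \<infinity>) \<and>
                   (\<lambda>t. enn2real (l2_bound f j t)) \<in> Lp_loc p) \<and>
          (\<forall>r>0. (SUP f\<in>\<Union>E. \<integral>\<^sup>+ t. l2_bound f j t ^ q \<partial>lebesgue_on {-r..r}) < \<infinity>))"

definition rat_intervals :: "real set set" where
  "rat_intervals = {{a..b} | a b. a \<in> \<rat> \<and> b \<in> \<rat> \<and> a \<le> b}"

type_synonym moduli = "real set \<Rightarrow> nat \<Rightarrow> real \<Rightarrow> real"

text \<open>Only the values \<open>\<theta> I j s\<close> with \<open>I \<in> rat_intervals\<close> and \<open>s \<ge> 0\<close> are relevant.\<close>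

definition suitable_moduli :: "moduli \<Rightarrow> bool" where
  "suitable_moduli \<theta> \<longleftrightarrow>
     (\<forall>I\<in>rat_intervals. \<forall>j. \<theta> I j ` {0..} \<subseteq> {0..} \<and> mono_on {0..} (\<theta> I j) \<and>
        continuous_on {0..} (\<theta> I j) \<and> \<theta> I j 0 = 0) \<and>
     (\<forall>I1\<in>rat_intervals. \<forall>I2\<in>rat_intervals. \<forall>j1 j2. I1 \<subseteq> I2 \<longrightarrow> j1 \<le> j2 \<longrightarrow>
        (\<forall>s\<ge>0. \<theta> I1 j1 s \<le> \<theta> I2 j2 s))"

text \<open>
  Elements of \<open>C(I, B\<^sub>j)\<close> are represented by total functions whose values outside \<open>I\<close> are arbitrary;
  these values are never used below.
\<close>

definition C_ball :: "real set \<Rightarrow> nat \<Rightarrow> (real \<Rightarrow> real ^ 'n::finite) set" where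
  "C_ball I j = {x. continuous_on I x \<and> x ` I \<subseteq> cball 0 (real j)}"

definition C_moduli :: "moduli \<Rightarrow> real set \<Rightarrow> nat \<Rightarrow> (real \<Rightarrow> real ^ 'n::finite) set" where
  "C_moduli \<theta> I j = {x \<in> C_ball I j. \<forall>t\<in>I. \<forall>s\<in>I. norm (x t - x s) \<le> \<theta> I j \<bar>t - s\<bar>}"

abbreviation shift :: "real set \<Rightarrow> real set" where
  "shift I \<equiv> (\<lambda>t. t - 1) ` I"

text \<open>
  The generating families of seminorms. On \<open>SC_fun p\<close> (respectively \<open>SC_fun 1\<close> for the last two)
  the integrals exist and the suprema are finite, because \<open>f\<close> is dominated on compact sets by a
  function of \<open>Lp_loc p\<close>; the seminorms do not depend on the representative of a class.
\<close>

definition T_D_seminorms :: "nat \<Rightarrow> moduli \<Rightarrow> (real ^ 'n::finite) set \<Rightarrow> ('n field \<Rightarrow> real) set" where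
  "T_D_seminorms p \<theta> D =
     {\<lambda>f. SUP x \<in> C_moduli \<theta> I j. root p (LINT t|lebesgue_on I. norm (f (t, x t, u)) ^ p)
        | I j u. I \<in> rat_intervals \<and> u \<in> D}"

definition T_moduli_seminorms :: "nat \<Rightarrow> moduli \<Rightarrow> moduli \<Rightarrow> (('n::finite) field \<Rightarrow> real) set" where
  "T_moduli_seminorms p \<theta> \<theta>' =
     {\<lambda>f. SUP (x, u) \<in> C_moduli \<theta> I j \<times> C_moduli \<theta>' (shift I) j.
        root p (LINT t|lebesgue_on I. norm (f (t, x t, u (t - 1))) ^ p)
        | I j. I \<in> rat_intervals}"

definition T_B_seminorms :: "nat \<Rightarrow> moduli \<Rightarrow> (('n::finite) field \<Rightarrow> real) set" where
  "T_B_seminorms p \<theta> =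
     {\<lambda>f. SUP (x, u) \<in> C_moduli \<theta> I j \<times> C_ball (shift I) j.
        root p (LINT t|lebesgue_on I. norm (f (t, x t, u (t - 1))) ^ p)
        | I j. I \<in> rat_intervals}"

definition sigma_D_seminorms :: "moduli \<Rightarrow> (real ^ 'n::finite) set \<Rightarrow> ('n field \<Rightarrow> real) set" where
  "sigma_D_seminorms \<theta> D =
     {\<lambda>f. SUP x \<in> C_moduli \<theta> I j. norm (LINT t|lebesgue_on I. f (t, x t, u))
        | I j u. I \<in> rat_intervals \<and> u \<in> D}"

definition sigma_moduli_seminorms :: "moduli \<Rightarrow> moduli \<Rightarrow> (('n::finite) field \<Rightarrow> real) set" where
  "sigma_moduli_seminorms \<theta> \<theta>' =
     {\<lambda>f. SUP (x, u) \<in> C_moduli \<theta> I j \<times> C_moduli \<theta>' (shift I) j.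
        norm (LINT t|lebesgue_on I. f (t, x t, u (t - 1)))
        | I j. I \<in> rat_intervals}"

text \<open>
  The topology on a space \<open>X\<close> of classes generated by a family \<open>P\<close> of seminorms: the open balls
  of the seminorms form a subbase. As the seminorms do not depend on representatives, it is
  immaterial which ones witness membership in a ball.
\<close>

definition seminorm_topology ::
    "('n::finite) field set set \<Rightarrow> ('n field \<Rightarrow> real) set \<Rightarrow> 'n field set topology" where
  "seminorm_topology X P =
     topology_generated_by
       {{G \<in> X. \<exists>f\<in>F. \<exists>g\<in>G. \<rho> (\<lambda>w. g w - f w) < \<epsilon>} | F \<rho> \<epsilon>. F \<in> X \<and> \<rho> \<in> P \<and> \<epsilon> > 0}"

definition T_D :: "nat \<Rightarrow> moduli \<Rightarrow> (real ^ 'n::finite) set \<Rightarrow> 'n field set topology" where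
  "T_D p \<theta> D = seminorm_topology (SC p) (T_D_seminorms p \<theta> D)"

definition T_moduli :: "nat \<Rightarrow> moduli \<Rightarrow> moduli \<Rightarrow> ('n::finite) field set topology" where
  "T_moduli p \<theta> \<theta>' = seminorm_topology (SC p) (T_moduli_seminorms p \<theta> \<theta>')"

definition T_B :: "nat \<Rightarrow> moduli \<Rightarrow> ('n::finite) field set topology" where
  "T_B p \<theta> = seminorm_topology (SC p) (T_B_seminorms p \<theta>)"

definition sigma_D :: "moduli \<Rightarrow> (real ^ 'n::finite) set \<Rightarrow> 'n field set topology" where
  "sigma_D \<theta> D = seminorm_topology (SC 1) (sigma_D_seminorms \<theta> D)"

definition sigma_moduli :: "moduli \<Rightarrow> moduli \<Rightarrow> ('n::finite) field set topology" where
  "sigma_moduli \<theta> \<theta>' = seminorm_topology (SC 1) (sigma_moduli_seminorms \<theta> \<theta>')"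

end

theory Submission imports Defs begin

text \<open>The two kinds of topology differ in how the net point v replacing u(t - 1) may depend on
  t. With the norm inside the integral, v may be chosen separately for every t: the sum over the
  whole net dominates the chosen term, and Minkowski's inequality bounds that sum. Nothing about the
  variation of u in t enters, so arbitrary continuous delays are reached. With the norm outside the
  integral, smallness of the integrals for each fixed v gives no pointwise smallness, because of
  cancellation. There v has to stay constant on subintervals, and integrals over these have to be
  recovered from the seminorms. The common modulus of the delays provides one partition for all u,
  so that finitely many seminorms suffice. The same distinction decides the use of x: in the first
  case the paths x stay as they are, in the second they are also modified, because a seminorm over a
  smaller interval admits fewer paths.\<close>

text \<open>
  On \<open>SC p\<close> the topology \<open>T_D\<close> is weaker than \<open>T_moduli\<close>, which is weaker than \<open>T_B\<close>, because
  constant functions are among the delays with a modulus, and those are continuous. Conversely, let f be an arbitrary point of \<open>SC p\<close>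
  and g an element of E. Replacing the delay u by the elements of a finite net in D changes
  \<open>g - f\<close> by at most the mesh times the \<open>l\<^sub>2\<close>-bound of g, which is uniformly bounded in the mean
  over E, plus the modulus of continuity of f alone. The latter tends to zero in the mean by
  dominated convergence, so f needs no \<open>l\<^sub>2\<close>-bound; hence f may be any point of the closure and no
  regularity of limits has to be established. For the weak topologies the delay is replaced by a
  step function on a rational partition of the interval that is fine for its modulus.
\<close>

subsection \<open>Minkowski's inequality\<close>

text \<open>Convexity of the n-th power on the half line at (a + b) / (A + B), which is the average
  of a / A and b / B with weights A / (A + B) and B / (A + B). In Minkowski's inequality A and B
  approximate the norms of the two functions; A = B = 1 gives the crude bound behind
  integrability.\<close>

lemma power_add_convex_bound:
  fixes a b A B :: real
  assumes "0 \<le> a" "0 \<le> b" "0 < A" "0 < B"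
  shows "(a + b) ^ n \<le> (A + B) ^ n * (A / (A + B) * (a / A) ^ n + B / (A + B) * (b / B) ^ n)"
proof -
  have cv: "convex_on {0::real..} (\<lambda>x. x ^ n)"
    using convex_power_even[of n] convex_power_odd[of n]
    by (cases "even n") (auto intro: convex_on_subset)
  have s: "A + B > 0" using assms by simp
  have r: "1 - B / (A + B) = A / (A + B)" using s by (simp add: field_simps)
  have eq: "(a + b) / (A + B) = (1 - B / (A + B)) * (a / A) + B / (A + B) * (b / B)"
    unfolding r using assms by (simp add: add_divide_distrib)
  have "((a + b) / (A + B)) ^ n \<le> (1 - B / (A + B)) * (a / A) ^ n + B / (A + B) * (b / B) ^ n"
    unfolding eq using convex_onD[OF cv, of "B / (A + B)" "a / A" "b / B"] assms by simp
  then have "(A + B) ^ n * ((a + b) / (A + B)) ^ n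
      \<le> (A + B) ^ n * (A / (A + B) * (a / A) ^ n + B / (A + B) * (b / B) ^ n)"
    using s unfolding r by (intro mult_left_mono) auto
  moreover have "(A + B) ^ n * ((a + b) / (A + B)) ^ n = (a + b) ^ n"
    using s by (simp flip: power_mult_distrib)
  ultimately show ?thesis by simp
qed

lemma integrable_add_power:
  fixes f g :: "'a \<Rightarrow> real"
  assumes "f \<in> borel_measurable M" "g \<in> borel_measurable M"
    and "\<And>t. 0 \<le> f t" "\<And>t. 0 \<le> g t"
    and "integrable M (\<lambda>t. f t ^ n)" "integrable M (\<lambda>t. g t ^ n)"
  shows "integrable M (\<lambda>t. (f t + g t) ^ n)"
proof (rule Bochner_Integration.integrable_bound)
  show "integrable M (\<lambda>t. 2 ^ n * (f t ^ n / 2 + g t ^ n / 2))"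
    using assms by auto
  show "(\<lambda>t. (f t + g t) ^ n) \<in> borel_measurable M" using assms by auto
  have "(f t + g t) ^ n \<le> 2 ^ n * (f t ^ n / 2 + g t ^ n / 2)" for t
    using power_add_convex_bound[of "f t" "g t" 1 1 n] assms by simp
  then show "AE t in M. norm ((f t + g t) ^ n) \<le> norm (2 ^ n * (f t ^ n / 2 + g t ^ n / 2))"
    using assms(3,4) by (auto intro!: AE_I2)
qed

text \<open>When A and B are at least the two norms, the bracket in
  \<open>power_add_convex_bound\<close> has integral at most 1, which leaves (A + B)^n.\<close>

lemma Minkowski_add:
  fixes f g :: "'a \<Rightarrow> real"
  assumes n: "1 \<le> n" and f: "f \<in> borel_measurable M" and g: "g \<in> borel_measurable M"
    and f0: "\<And>t. 0 \<le> f t" and g0: "\<And>t. 0 \<le> g t"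
    and fi: "integrable M (\<lambda>t. f t ^ n)" and gi: "integrable M (\<lambda>t. g t ^ n)"
  shows "root n (LINT t|M. (f t + g t) ^ n) \<le> root n (LINT t|M. f t ^ n) + root n (LINT t|M. g t ^ n)"
proof (rule field_le_epsilon)
  fix e :: real assume e: "e > 0"
  define a where "a = root n (LINT t|M. f t ^ n)"
  define b where "b = root n (LINT t|M. g t ^ n)"
  \<comment> \<open>The convexity bound divides by A and B, while a norm may vanish. Enlarging each
    norm by e / 2 makes both positive at a total cost of e.\<close>
  define A where "A = a + e / 2"
  define B where "B = b + e / 2"
  have If: "0 \<le> (LINT t|M. f t ^ n)" and Ig: "0 \<le> (LINT t|M. g t ^ n)"
    using f0 g0 by (auto intro!: integral_nonneg_AE)
  have a0: "0 \<le> a" "0 \<le> b" using If Ig n by (auto simp: a_def b_def)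
  have AB: "A > 0" "B > 0" "a \<le> A" "b \<le> B" using a0 e by (auto simp: A_def B_def)
  have "(LINT t|M. f t ^ n) = a ^ n" "(LINT t|M. g t ^ n) = b ^ n"
    using n If Ig by (simp_all add: a_def b_def)
  then have le: "(LINT t|M. f t ^ n) / A ^ n \<le> 1" "(LINT t|M. g t ^ n) / B ^ n \<le> 1"
    using AB a0 by (auto simp: power_mono)
  have "(LINT t|M. (f t + g t) ^ n)
      \<le> (LINT t|M. (A + B) ^ n * (A / (A + B) * (f t ^ n / A ^ n) + B / (A + B) * (g t ^ n / B ^ n)))"
    using power_add_convex_bound[OF f0 g0 AB(1,2)] fi gi
    by (intro integral_mono integrable_add_power f g f0 g0) (auto simp: power_divide)
  also have "\<dots> = (A + B) ^ n * (A / (A + B) * ((LINT t|M. f t ^ n) / A ^ n)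
      + B / (A + B) * ((LINT t|M. g t ^ n) / B ^ n))"
    using fi gi by simp
  also have "\<dots> \<le> (A + B) ^ n * (A / (A + B) * 1 + B / (A + B) * 1)"
    using AB le by (intro mult_left_mono add_mono) auto
  also have "\<dots> = (A + B) ^ n"
    using AB by (simp flip: add_divide_distrib)
  finally have "root n (LINT t|M. (f t + g t) ^ n) \<le> root n ((A + B) ^ n)"
    using n by simp
  also have "\<dots> = a + b + e"
    using n AB by (simp add: real_root_power_cancel A_def B_def)
  finally show "root n (LINT t|M. (f t + g t) ^ n)
      \<le> root n (LINT t|M. f t ^ n) + root n (LINT t|M. g t ^ n) + e"
    by (simp add: a_def b_def)
qed

lemma integrable_power_bound:
  fixes f :: "'a \<Rightarrow> real" and h :: "'a \<Rightarrow> 'b::{banach, second_countable_topology}"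
  assumes "h \<in> borel_measurable M" and "integrable M (\<lambda>t. f t ^ n)"
    and "AE t in M. norm (h t) \<le> f t"
  shows "integrable M (\<lambda>t. norm (h t) ^ n)"
proof (rule Bochner_Integration.integrable_bound[OF assms(2)])
  show "(\<lambda>t. norm (h t) ^ n) \<in> borel_measurable M" using assms by auto
  show "AE t in M. norm (norm (h t) ^ n) \<le> norm (f t ^ n)"
    using assms(3)
  proof eventually_elim
    case (elim t)
    then have "norm (h t) ^ n \<le> f t ^ n" by (intro power_mono) auto
    then show ?case by simp
  qed
qed

lemma root_integral_mono:
  fixes f :: "'a \<Rightarrow> real" and h :: "'a \<Rightarrow> 'b::{banach, second_countable_topology}"
  assumes "1 \<le> n" "h \<in> borel_measurable M" and "integrable M (\<lambda>t. f t ^ n)"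
    and "AE t in M. norm (h t) \<le> f t"
  shows "root n (LINT t|M. norm (h t) ^ n) \<le> root n (LINT t|M. f t ^ n)"
proof -
  have "(LINT t|M. norm (h t) ^ n) \<le> (LINT t|M. f t ^ n)"
  proof (rule integral_mono_AE)
    show "integrable M (\<lambda>t. norm (h t) ^ n)" by (rule integrable_power_bound) fact+
    show "AE t in M. norm (h t) ^ n \<le> f t ^ n"
      using assms(4) by eventually_elim (auto intro: power_mono)
  qed fact
  then show ?thesis using assms(1) by simp
qed

text \<open>Integrability belongs to the claim because the induction step passes the partial sum to
  \<open>Minkowski_add\<close>.\<close>

lemma Minkowski_sum:
  fixes f :: "'i \<Rightarrow> 'a \<Rightarrow> real"
  assumes n: "1 \<le> n" and "finite V"
    and "\<And>i. i \<in> V \<Longrightarrow> f i \<in> borel_measurable M"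
    and "\<And>i t. 0 \<le> f i t"
    and "\<And>i. i \<in> V \<Longrightarrow> integrable M (\<lambda>t. f i t ^ n)"
  shows "integrable M (\<lambda>t. (\<Sum>i\<in>V. f i t) ^ n) \<and>
         root n (LINT t|M. (\<Sum>i\<in>V. f i t) ^ n) \<le> (\<Sum>i\<in>V. root n (LINT t|M. f i t ^ n))"
  using \<open>finite V\<close> assms(3,5)
proof (induction V)
  case empty
  show ?case using n by (simp add: power_0_left)
next
  case (insert i V)
  have m: "(\<lambda>t. \<Sum>i\<in>V. f i t) \<in> borel_measurable M"
    using insert.prems(1) by (intro borel_measurable_sum) auto
  have IH: "integrable M (\<lambda>t. (\<Sum>i\<in>V. f i t) ^ n)"
      "root n (LINT t|M. (\<Sum>i\<in>V. f i t) ^ n) \<le> (\<Sum>i\<in>V. root n (LINT t|M. f i t ^ n))"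
    using insert by auto
  note * = insert.prems(1)[of i] m assms(4)[of i] sum_nonneg[OF assms(4)]
    insert.prems(2)[of i] IH(1)
  have "integrable M (\<lambda>t. (f i t + (\<Sum>i\<in>V. f i t)) ^ n)"
    by (rule integrable_add_power) (use * in auto)
  moreover have "root n (LINT t|M. (f i t + (\<Sum>i\<in>V. f i t)) ^ n)
      \<le> root n (LINT t|M. f i t ^ n) + root n (LINT t|M. (\<Sum>i\<in>V. f i t) ^ n)"
    by (rule Minkowski_add[OF n]) (use * in auto)
  ultimately show ?case using insert.hyps IH(2) by simp
qed

subsection \<open>Strong Caratheodory functions\<close>

lemma Lp_loc_add:
  assumes "m \<in> Lp_loc p" "m' \<in> Lp_loc p"
  shows "(\<lambda>t. \<bar>m t\<bar> + \<bar>m' t\<bar>) \<in> Lp_loc p"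
  unfolding Lp_loc_def
proof (intro CollectI allI conjI)
  fix a b :: real
  have m: "m \<in> borel_measurable (lebesgue_on {a..b})" "m' \<in> borel_measurable (lebesgue_on {a..b})"
    "integrable (lebesgue_on {a..b}) (\<lambda>t. \<bar>m t\<bar> ^ p)" "integrable (lebesgue_on {a..b}) (\<lambda>t. \<bar>m' t\<bar> ^ p)"
    using assms by (auto simp: Lp_loc_def)
  then show "(\<lambda>t. \<bar>m t\<bar> + \<bar>m' t\<bar>) \<in> borel_measurable (lebesgue_on {a..b})" by simp
  show "integrable (lebesgue_on {a..b}) (\<lambda>t. \<bar>\<bar>m t\<bar> + \<bar>m' t\<bar>\<bar> ^ p)"
    using integrable_add_power[of "\<lambda>t. \<bar>m t\<bar>" "lebesgue_on {a..b}" "\<lambda>t. \<bar>m' t\<bar>" p] m by simp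
qed

text \<open>On a bounded interval constants are integrable, and |s| is at most 1 + |s|^p.\<close>

lemma Lp_loc_subset:
  assumes "1 \<le> p"
  shows "Lp_loc p \<subseteq> Lp_loc 1"
proof
  fix m :: "real \<Rightarrow> real" assume "m \<in> Lp_loc p"
  then have m: "m \<in> borel_measurable (lebesgue_on {a..b})"
    "integrable (lebesgue_on {a..b}) (\<lambda>t. \<bar>m t\<bar> ^ p)" for a b
    by (auto simp: Lp_loc_def)
  have "integrable (lebesgue_on {a..b}) (\<lambda>t. \<bar>m t\<bar> ^ 1)" for a b
  proof (rule Bochner_Integration.integrable_bound)
    show "integrable (lebesgue_on {a..b}) (\<lambda>t. 1 + \<bar>m t\<bar> ^ p)"
      using m(2)[of a b] by (intro Bochner_Integration.integrable_add finite_measure.integrable_const)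
        (auto intro!: finite_measure_lebesgue_on)
    show "(\<lambda>t. \<bar>m t\<bar> ^ 1) \<in> borel_measurable (lebesgue_on {a..b})" using m by simp
    have "\<bar>m t\<bar> \<le> 1 + \<bar>m t\<bar> ^ p" for t
    proof (cases "\<bar>m t\<bar> \<le> 1")
      case False
      then have "\<bar>m t\<bar> ^ 1 \<le> \<bar>m t\<bar> ^ p" using assms by (intro power_increasing) auto
      then show ?thesis by simp
    qed (auto intro: order_trans[of _ 1])
    then show "AE t in lebesgue_on {a..b}. norm (\<bar>m t\<bar> ^ 1) \<le> norm (1 + \<bar>m t\<bar> ^ p)"
      by (intro AE_I2) (smt (verit) power_one_right real_norm_def zero_le_power_abs)
  qed
  then show "m \<in> Lp_loc 1" using m by (auto simp: Lp_loc_def)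
qed

lemma SC_fun_subset: "1 \<le> p \<Longrightarrow> SC_fun p \<subseteq> SC_fun 1"
  unfolding SC_fun_def using Lp_loc_subset by blast

lemma SC_fun_diff:
  fixes f g :: "'n::finite field"
  assumes f: "f \<in> SC_fun p" and g: "g \<in> SC_fun p"
  shows "(\<lambda>w. g w - f w) \<in> SC_fun p"
  unfolding SC_fun_def
proof (intro CollectI conjI allI impI)
  show "(\<lambda>w. g w - f w) \<in> borel_measurable borel"
    using f g by (auto simp: SC_fun_def)
  have "AE t in lebesgue. continuous_on UNIV (\<lambda>z. f (t, z))"
    "AE t in lebesgue. continuous_on UNIV (\<lambda>z. g (t, z))"
    using f g by (auto simp: SC_fun_def)
  then show "AE t in lebesgue. continuous_on UNIV (\<lambda>z. g (t, z) - f (t, z))"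
    by eventually_elim (intro continuous_intros)
  fix K :: "((real ^ 'n) \<times> (real ^ 'n)) set" assume "compact K"
  then obtain m m' where m: "m \<in> Lp_loc p" "AE t in lebesgue. \<forall>z\<in>K. norm (f (t, z)) \<le> m t"
    and m': "m' \<in> Lp_loc p" "AE t in lebesgue. \<forall>z\<in>K. norm (g (t, z)) \<le> m' t"
    using f g by (fastforce simp: SC_fun_def)
  from m(2) m'(2)
  have "AE t in lebesgue. \<forall>z\<in>K. norm (g (t, z) - f (t, z)) \<le> \<bar>m t\<bar> + \<bar>m' t\<bar>"
  proof eventually_elim
    case (elim t)
    show ?case
    proof
      fix z assume "z \<in> K"
      then show "norm (g (t, z) - f (t, z)) \<le> \<bar>m t\<bar> + \<bar>m' t\<bar>"
        using elim norm_triangle_ineq4[of "g (t, z)" "f (t, z)"] by fastforce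
    qed
  qed
  then show "\<exists>m\<in>Lp_loc p. AE t in lebesgue. \<forall>z\<in>K. norm (g (t, z) - f (t, z)) \<le> m t"
    by (intro bexI[where x = "\<lambda>t. \<bar>m t\<bar> + \<bar>m' t\<bar>"] Lp_loc_add m m')
qed

text \<open>Fubini gives equality for almost every z, and continuity in z removes the exceptional set.\<close>

lemma SC_eq_AE_slices:
  fixes f g :: "'n::finite field"
  assumes "(f, g) \<in> SC_eq"
  shows "AE t in lebesgue. \<forall>z. f (t, z) = g (t, z)"
proof -
  have f: "f \<in> borel_measurable borel" "g \<in> borel_measurable borel"
    and cf: "AE t in lborel. continuous_on UNIV (\<lambda>z. f (t, z))"
    and cg: "AE t in lborel. continuous_on UNIV (\<lambda>z. g (t, z))"
    and eq: "AE w in lborel. f w = g w"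
    using assms by (auto simp: SC_eq_def SC_fun_def AE_completion_iff)
  have [measurable]: "f \<in> borel_measurable (lborel \<Otimes>\<^sub>M lborel)" "g \<in> borel_measurable (lborel \<Otimes>\<^sub>M lborel)"
    using f by (simp_all add: lborel_prod)
  have "AE t in lborel. AE z in lborel. f (t, z) = g (t, z)"
    using eq by (subst (asm) lborel_prod[symmetric]) (rule lborel_pair.AE_pair)
  with cf cg have "AE t in lborel. \<forall>z. f (t, z) = g (t, z)"
  proof eventually_elim
    case (elim t)
    have "open {z. f (t, z) \<noteq> g (t, z)}"
      using elim by (intro open_Collect_neq) auto
    moreover have "{z. f (t, z) \<noteq> g (t, z)} \<in> null_sets lborel"
      using elim(3) calculation by (subst AE_iff_null_sets) auto
    ultimately show ?case
      using open_not_negligible null_sets_completionI negligible_iff_null_sets by blast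
  qed
  then show ?thesis by (simp add: AE_completion_iff)
qed

lemma equiv_SC_eq: "equiv (SC_fun 1) SC_eq"
proof (rule equivI)
  show "SC_eq \<subseteq> SC_fun 1 \<times> SC_fun 1" by (auto simp: SC_eq_def)
  show "refl_on (SC_fun 1) SC_eq" by (auto simp: refl_on_def SC_eq_def)
  show "sym SC_eq" by (auto simp: sym_def SC_eq_def elim: eventually_mono)
  show "trans SC_eq"
  proof (rule transI)
    fix f g h :: "'b field" assume "(f, g) \<in> SC_eq" "(g, h) \<in> SC_eq"
    then show "(f, h) \<in> SC_eq" by (auto simp: SC_eq_def elim: eventually_elim2)
  qed
qed

text \<open>Classes are formed inside \<open>SC_fun 1\<close>, so the exponent p has to be carried
  from one representative to another. Equality of almost all slices lets both share the same
  dominating function.\<close>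

lemma SC_eq_transfer:
  fixes f g :: "'n::finite field"
  assumes "(f, g) \<in> SC_eq" "f \<in> SC_fun p"
  shows "g \<in> SC_fun p"
proof -
  have eq: "AE t in lebesgue. \<forall>z. f (t, z) = g (t, z)" by (rule SC_eq_AE_slices) fact
  show ?thesis unfolding SC_fun_def
  proof (intro CollectI conjI allI impI)
    show "g \<in> borel_measurable borel" using assms by (auto simp: SC_eq_def SC_fun_def)
    show "AE t in lebesgue. continuous_on UNIV (\<lambda>z. g (t, z))"
      using assms by (auto simp: SC_eq_def SC_fun_def)
    fix K :: "((real ^ 'n) \<times> (real ^ 'n)) set" assume "compact K"
    then obtain m where "m \<in> Lp_loc p" and m: "AE t in lebesgue. \<forall>z\<in>K. norm (f (t, z)) \<le> m t"
      using assms by (fastforce simp: SC_fun_def)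
    moreover have "AE t in lebesgue. \<forall>z\<in>K. norm (g (t, z)) \<le> m t"
      using eq m by eventually_elim auto
    ultimately show "\<exists>m\<in>Lp_loc p. AE t in lebesgue. \<forall>z\<in>K. norm (g (t, z)) \<le> m t" by blast
  qed
qed

lemma SC_class:
  fixes F :: "'n::finite field set"
  assumes "1 \<le> p" "F \<in> SC p"
  shows "F \<noteq> {}" "F \<subseteq> SC_fun p" "\<And>f g. f \<in> F \<Longrightarrow> g \<in> F \<Longrightarrow> (f, g) \<in> SC_eq"
proof -
  obtain h where h: "h \<in> SC_fun p" "F = SC_eq `` {h}"
    using assms by (auto simp: SC_def elim: quotientE)
  then have "h \<in> SC_fun 1" using SC_fun_subset[OF assms(1)] by auto
  then show "F \<noteq> {}" using h by (auto simp: SC_eq_def)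
  show "F \<subseteq> SC_fun p" using h by (auto intro: SC_eq_transfer)
  show "(f, g) \<in> SC_eq" if "f \<in> F" "g \<in> F" for f g
    using that h equiv_SC_eq by (auto simp: equiv_def dest: symD transD)
qed

lemma SC_subset: "1 \<le> p \<Longrightarrow> SC p \<subseteq> SC 1"
  unfolding SC_def quotient_def using SC_fun_subset by blast

subsection \<open>Comparison of seminorm topologies relative to a subset\<close>

text \<open>The point x ranges over the whole space, while the inclusion is tested only on E. Points
  outside E matter for the closures, and the estimates rest on the l2-bounds of elements of E; this
  relation accommodates both.\<close>

definition weaker_on :: "'a set \<Rightarrow> 'a topology \<Rightarrow> 'a topology \<Rightarrow> bool" where
  "weaker_on E T1 T2 \<longleftrightarrow>
     (\<forall>U x. openin T1 U \<and> x \<in> U \<longrightarrow> (\<exists>W. openin T2 W \<and> x \<in> W \<and> W \<inter> E \<subseteq> U))"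

lemma weaker_on_trans:
  assumes "weaker_on E T1 T2" "weaker_on E T2 T3"
  shows "weaker_on E T1 T3"
  unfolding weaker_on_def
proof (intro allI impI)
  fix U x assume "openin T1 U \<and> x \<in> U"
  then obtain W where W: "openin T2 W" "x \<in> W" "W \<inter> E \<subseteq> U"
    using assms(1) unfolding weaker_on_def by meson
  then obtain V where "openin T3 V" "x \<in> V" "V \<inter> E \<subseteq> W"
    using assms(2) unfolding weaker_on_def by meson
  then show "\<exists>W. openin T3 W \<and> x \<in> W \<and> W \<inter> E \<subseteq> U" using W by blast
qed

lemma weaker_on_openin_subtopology:
  assumes "weaker_on E T1 T2" and "openin (subtopology T1 E) S"
  shows "openin (subtopology T2 E) S"
proof (subst openin_subopen, intro ballI)
  fix x assume "x \<in> S"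
  from assms(2) obtain U where U: "openin T1 U" "S = U \<inter> E" by (auto simp: openin_subtopology)
  then obtain W where "openin T2 W" "x \<in> W" "W \<inter> E \<subseteq> U"
    using assms(1) \<open>x \<in> S\<close> unfolding weaker_on_def by (meson IntD1)
  then show "\<exists>T. openin (subtopology T2 E) T \<and> x \<in> T \<and> T \<subseteq> S"
    using U \<open>x \<in> S\<close> by (intro exI[of _ "W \<inter> E"]) (auto simp: openin_subtopology)
qed

text \<open>Each \<open>T1\<close>-neighbourhood of a limit point x, possibly outside E, contains
  the trace on E of a \<open>T2\<close>-neighbourhood of x, and that trace is nonempty.\<close>

lemma weaker_on_closure:
  assumes "weaker_on E T1 T2" and "topspace T2 \<subseteq> topspace T1"
  shows "T2 closure_of E \<subseteq> T1 closure_of E"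
proof
  fix x assume x: "x \<in> T2 closure_of E"
  have "\<exists>y. y \<in> E \<and> y \<in> U" if "x \<in> U" "openin T1 U" for U
  proof -
    from that assms(1) obtain W where "openin T2 W" "x \<in> W" "W \<inter> E \<subseteq> U"
      unfolding weaker_on_def by meson
    then show ?thesis using x unfolding in_closure_of by blast
  qed
  then show "x \<in> T1 closure_of E" using x assms(2) unfolding in_closure_of by blast
qed

lemma weaker_on_antisym:
  assumes "weaker_on E T1 T2" "weaker_on E T2 T1" and "topspace T1 = topspace T2"
  shows "subtopology T1 E = subtopology T2 E \<and> T1 closure_of E = T2 closure_of E"
  unfolding topology_eq
  using weaker_on_openin_subtopology[OF assms(1)] weaker_on_openin_subtopology[OF assms(2)]
    weaker_on_closure[OF assms(1)] weaker_on_closure[OF assms(2)] assms(3)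
  by blast

text \<open>
  \<open>adapted p \<rho>\<close> says that \<open>\<rho> (g - f)\<close> induces a pseudometric on the classes of \<open>SC p\<close>.
\<close>

definition adapted :: "nat \<Rightarrow> (('n::finite) field \<Rightarrow> real) \<Rightarrow> bool" where
  "adapted p \<rho> \<longleftrightarrow>
     (\<forall>f\<in>SC_fun p. \<rho> (\<lambda>w. f w - f w) = 0) \<and>
     (\<forall>f\<in>SC_fun p. \<forall>g\<in>SC_fun p. \<forall>h\<in>SC_fun p.
        \<rho> (\<lambda>w. h w - f w) \<le> \<rho> (\<lambda>w. h w - g w) + \<rho> (\<lambda>w. g w - f w)) \<and>
     (\<forall>f\<in>SC_fun p. \<forall>f'\<in>SC_fun p. \<forall>g\<in>SC_fun p. \<forall>g'\<in>SC_fun p.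
        (f, f') \<in> SC_eq \<longrightarrow> (g, g') \<in> SC_eq \<longrightarrow> \<rho> (\<lambda>w. g w - f w) = \<rho> (\<lambda>w. g' w - f' w))"

lemma adaptedD:
  assumes "adapted p \<rho>"
  shows adapted_zero: "\<And>f. f \<in> SC_fun p \<Longrightarrow> \<rho> (\<lambda>w. f w - f w) = 0"
    and adapted_triangle: "\<And>f g h. f \<in> SC_fun p \<Longrightarrow> g \<in> SC_fun p \<Longrightarrow> h \<in> SC_fun p \<Longrightarrow>
      \<rho> (\<lambda>w. h w - f w) \<le> \<rho> (\<lambda>w. h w - g w) + \<rho> (\<lambda>w. g w - f w)"
    and adapted_cong: "\<And>f f' g g'. f \<in> SC_fun p \<Longrightarrow> f' \<in> SC_fun p \<Longrightarrow> g \<in> SC_fun p \<Longrightarrow>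
      g' \<in> SC_fun p \<Longrightarrow> (f, f') \<in> SC_eq \<Longrightarrow> (g, g') \<in> SC_eq \<Longrightarrow>
      \<rho> (\<lambda>w. g w - f w) = \<rho> (\<lambda>w. g' w - f' w)"
  subgoal for f by (rule assms[unfolded adapted_def, THEN conjunct1, rule_format])
  subgoal for f g h
    by (rule assms[unfolded adapted_def, THEN conjunct2, THEN conjunct1, rule_format])
  subgoal for f f' g g'
    by (rule assms[unfolded adapted_def, THEN conjunct2, THEN conjunct2, rule_format])
  done

section \<open>Balls and neighbourhoods in a seminorm topology\<close>

definition seminorm_ball ::
    "('n::finite) field set set \<Rightarrow> ('n field \<Rightarrow> real) \<Rightarrow> 'n field set \<Rightarrow> real \<Rightarrow> 'n field set set" where
  "seminorm_ball X \<rho> F e = {G \<in> X. \<exists>f\<in>F. \<exists>g\<in>G. \<rho> (\<lambda>w. g w - f w) < e}"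

lemma openin_seminorm_ball:
  "F \<in> X \<Longrightarrow> \<rho> \<in> P \<Longrightarrow> e > 0 \<Longrightarrow> openin (seminorm_topology X P) (seminorm_ball X \<rho> F e)"
  unfolding seminorm_topology_def seminorm_ball_def
  by (rule topology_generated_by_Basis) blast

text \<open>Membership is defined by some pair of representatives; adaptedness makes the pair
  immaterial, so later arguments may fix one representative per class.\<close>

lemma seminorm_ball_iff:
  fixes \<rho> :: "('n::finite) field \<Rightarrow> real"
  assumes p: "1 \<le> p" and \<rho>: "adapted p \<rho>" and F: "F \<in> SC p" "f \<in> F" and G: "G \<in> SC p" "g \<in> G"
  shows "G \<in> seminorm_ball (SC p) \<rho> F e \<longleftrightarrow> \<rho> (\<lambda>w. g w - f w) < e"
proof
  assume "G \<in> seminorm_ball (SC p) \<rho> F e"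
  then obtain f' g' where fg: "f' \<in> F" "g' \<in> G" "\<rho> (\<lambda>w. g' w - f' w) < e"
    unfolding seminorm_ball_def by blast
  note F' = SC_class(2,3)[OF p F(1)] and G' = SC_class(2,3)[OF p G(1)]
  have "\<rho> (\<lambda>w. g w - f w) = \<rho> (\<lambda>w. g' w - f' w)"
  proof (rule adapted_cong[OF \<rho>])
    show "f \<in> SC_fun p" "f' \<in> SC_fun p" "g \<in> SC_fun p" "g' \<in> SC_fun p"
      using F'(1) G'(1) F(2) G(2) fg(1,2) by auto
    show "(f, f') \<in> SC_eq" by (rule F'(2)[OF F(2) fg(1)])
    show "(g, g') \<in> SC_eq" by (rule G'(2)[OF G(2) fg(2)])
  qed
  with fg(3) show "\<rho> (\<lambda>w. g w - f w) < e" by argo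
next
  assume "\<rho> (\<lambda>w. g w - f w) < e"
  then show "G \<in> seminorm_ball (SC p) \<rho> F e"
    unfolding seminorm_ball_def by (intro CollectI conjI bexI[of _ f] bexI[of _ g] F G)
qed

text \<open>Every class lies in its own ball, since its distance to itself is zero; P must be
  nonempty to supply a ball at all.\<close>

lemma topspace_seminorm_topology:
  fixes P :: "(('n::finite) field \<Rightarrow> real) set"
  assumes p: "1 \<le> p" and "P \<noteq> {}" and P: "\<And>\<rho>. \<rho> \<in> P \<Longrightarrow> adapted p \<rho>"
  shows "topspace (seminorm_topology (SC p) P) = SC p"
proof
  show "topspace (seminorm_topology (SC p) P) \<subseteq> SC p"
    unfolding seminorm_topology_def topology_generated_by_topspace by blast
  show "SC p \<subseteq> topspace (seminorm_topology (SC p) P)"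
  proof
    fix F :: "'n field set" assume F: "F \<in> SC p"
    obtain \<rho> where \<rho>: "\<rho> \<in> P" using assms(2) by blast
    obtain f where f: "f \<in> F" "f \<in> SC_fun p" using SC_class[OF p F] by blast
    have "F \<in> seminorm_ball (SC p) \<rho> F 1"
      using seminorm_ball_iff[OF p P[OF \<rho>] F f(1) F f(1), of 1] adapted_zero[OF P[OF \<rho>] f(2)] by simp
    then show "F \<in> topspace (seminorm_topology (SC p) P)"
      using openin_subset[OF openin_seminorm_ball[OF F \<rho>, of 1]] by auto
  qed
qed

text \<open>Reduces the comparison to an epsilon-delta estimate in which the centre f is arbitrary
  and only g is taken from E. Intersections and unions preserve the neighbourhood property, so it
  suffices to treat subbasic balls, recentred at the given point.\<close>

lemma weaker_on_seminorm_topology: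
  fixes P Q :: "(('n::finite) field \<Rightarrow> real) set"
  assumes p: "1 \<le> p" and E: "E \<subseteq> SC p"
    and P: "\<And>\<rho>. \<rho> \<in> P \<Longrightarrow> adapted p \<rho>" and Q: "\<And>\<rho>. \<rho> \<in> Q \<Longrightarrow> adapted p \<rho>"
    and Q0: "Q \<noteq> {}"
    and control: "\<And>f \<rho> e. f \<in> SC_fun p \<Longrightarrow> \<rho> \<in> P \<Longrightarrow> e > 0 \<Longrightarrow>
        \<exists>R d. finite R \<and> R \<subseteq> Q \<and> d > 0 \<and>
          (\<forall>g\<in>\<Union>E. (\<forall>\<rho>'\<in>R. \<rho>' (\<lambda>w. g w - f w) < d) \<longrightarrow> \<rho> (\<lambda>w. g w - f w) < e)"
  shows "weaker_on E (seminorm_topology (SC p) P) (seminorm_topology (SC p) Q)"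
proof -
  let ?T = "seminorm_topology (SC p) Q"
  let ?S = "{{G \<in> SC p. \<exists>f\<in>F. \<exists>g\<in>G. \<rho> (\<lambda>w. g w - f w) < \<epsilon>} | F \<rho> \<epsilon>. F \<in> SC p \<and> \<rho> \<in> P \<and> \<epsilon> > 0}"
  have "\<forall>F\<in>U. \<exists>W. openin ?T W \<and> F \<in> W \<and> W \<inter> E \<subseteq> U" if "generate_topology_on ?S U" for U
    using that
  proof (induction U)
    case Empty
    then show ?case by simp
  next
    case (Int A B)
    show ?case
    proof
      fix F assume "F \<in> A \<inter> B"
      then obtain V W where "openin ?T V" "F \<in> V" "V \<inter> E \<subseteq> A" "openin ?T W" "F \<in> W" "W \<inter> E \<subseteq> B"
        using Int.IH by (meson IntD1 IntD2)
      then show "\<exists>W. openin ?T W \<and> F \<in> W \<and> W \<inter> E \<subseteq> A \<inter> B"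
        by (intro exI[of _ "V \<inter> W"]) auto
    qed
  next
    case (UN K)
    show ?case
    proof
      fix F assume "F \<in> \<Union>K"
      then obtain k where "k \<in> K" "F \<in> k" by blast
      with UN.IH obtain W where "openin ?T W" "F \<in> W" "W \<inter> E \<subseteq> k" by meson
      with \<open>k \<in> K\<close> show "\<exists>W. openin ?T W \<and> F \<in> W \<and> W \<inter> E \<subseteq> \<Union>K" by blast
    qed
  next
    case (Basis U)
    then obtain F \<rho> e where F: "F \<in> SC p" and \<rho>: "\<rho> \<in> P" and U: "U = seminorm_ball (SC p) \<rho> F e"
      unfolding seminorm_ball_def by blast
    obtain f where f: "f \<in> F" "f \<in> SC_fun p" using SC_class[OF p F] by blast
    show ?case
    proof
      fix G assume GU: "G \<in> U"
      then have G: "G \<in> SC p" by (simp add: U seminorm_ball_def)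
      obtain g where g: "g \<in> G" "g \<in> SC_fun p" using SC_class[OF p G] by blast
      \<comment> \<open>The ball is centred at F, but a neighbourhood of G is wanted. The slack c is
        the radius around G that the triangle inequality leaves, and \<open>control\<close> is
        applied with centre g.\<close>
      define c where "c = e - \<rho> (\<lambda>w. g w - f w)"
      have "c > 0" using GU seminorm_ball_iff[OF p P[OF \<rho>] F f(1) G g(1)] by (simp add: U c_def)
      from control[OF g(2) \<rho> this] obtain R d where R: "finite R" "R \<subseteq> Q" "d > 0"
        and ctl: "\<And>h. h \<in> \<Union>E \<Longrightarrow> (\<forall>\<rho>'\<in>R. \<rho>' (\<lambda>w. h w - g w) < d) \<Longrightarrow> \<rho> (\<lambda>w. h w - g w) < c"
        by blast
      \<comment> \<open>Intersecting with the whole space covers the case of empty R, where the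
        intersection of the balls is the universal set and need not be open.\<close>
      define W where "W = (\<Inter>\<rho>'\<in>R. seminorm_ball (SC p) \<rho>' G d) \<inter> topspace ?T"
      have "openin ?T W"
        unfolding W_def using R G
        by (cases "R = {}") (auto intro!: openin_INT openin_Int openin_seminorm_ball)
      moreover have "G \<in> W"
      proof -
        have "G \<in> seminorm_ball (SC p) \<rho>' G d" if "\<rho>' \<in> R" for \<rho>'
        proof -
          have ad: "adapted p \<rho>'" using that R Q by blast
          then have "\<rho>' (\<lambda>w. g w - g w) = 0" using g(2) by (rule adapted_zero)
          then show ?thesis using seminorm_ball_iff[OF p ad G g(1) G g(1)] R by simp
        qed
        then show ?thesis
          unfolding W_def using topspace_seminorm_topology[OF p Q0 Q] G by auto
      qed
      moreover have "W \<inter> E \<subseteq> U"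
      proof
        fix H assume H: "H \<in> W \<inter> E"
        then have HS: "H \<in> SC p" using E by blast
        obtain h where h: "h \<in> H" "h \<in> SC_fun p" using SC_class[OF p HS] by blast
        have "\<rho>' (\<lambda>w. h w - g w) < d" if "\<rho>' \<in> R" for \<rho>'
        proof -
          have "adapted p \<rho>'" using that R Q by blast
          then show ?thesis
            using H that seminorm_ball_iff[OF p _ G g(1) HS h(1), of \<rho>' d] by (simp add: W_def)
        qed
        then have "\<rho> (\<lambda>w. h w - g w) < c" using ctl h H by blast
        moreover have "\<rho> (\<lambda>w. h w - f w) \<le> \<rho> (\<lambda>w. h w - g w) + \<rho> (\<lambda>w. g w - f w)"
          by (rule adapted_triangle[OF P[OF \<rho>] f(2) g(2) h(2)])
        ultimately have "\<rho> (\<lambda>w. h w - f w) < e" by (simp add: c_def)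
        then show "H \<in> U" using seminorm_ball_iff[OF p P[OF \<rho>] F f(1) HS h(1)] by (simp add: U)
      qed
      ultimately show "\<exists>W. openin ?T W \<and> G \<in> W \<and> W \<inter> E \<subseteq> U" by blast
    qed
  qed
  then show ?thesis
    unfolding weaker_on_def seminorm_topology_def[of "SC p" P] openin_topology_generated_by_iff
    by blast
qed

text \<open>The suprema are real, so the triangle inequality passes to them only with boundedness;
  it is available because differences stay in \<open>SC_fun p\<close>.\<close>

lemma adapted_SUP:
  fixes N :: "'i \<Rightarrow> ('n::finite) field \<Rightarrow> real"
  assumes S: "S \<noteq> {}" and N: "\<And>i. i \<in> S \<Longrightarrow> adapted p (N i)"
    and bdd: "\<And>f. f \<in> SC_fun p \<Longrightarrow> bdd_above ((\<lambda>i. N i f) ` S)"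
  shows "adapted p (\<lambda>f. SUP i\<in>S. N i f)"
  unfolding adapted_def
proof (intro conjI ballI impI)
  fix f g h :: "'n field" assume f: "f \<in> SC_fun p" and g: "g \<in> SC_fun p" and h: "h \<in> SC_fun p"
  show "(SUP i\<in>S. N i (\<lambda>w. h w - f w)) \<le> (SUP i\<in>S. N i (\<lambda>w. h w - g w)) + (SUP i\<in>S. N i (\<lambda>w. g w - f w))"
  proof (rule cSUP_least[OF S])
    fix i assume i: "i \<in> S"
    then have "N i (\<lambda>w. h w - f w) \<le> N i (\<lambda>w. h w - g w) + N i (\<lambda>w. g w - f w)"
      by (intro adapted_triangle[OF N] f g h)
    also have "\<dots> \<le> (SUP i\<in>S. N i (\<lambda>w. h w - g w)) + (SUP i\<in>S. N i (\<lambda>w. g w - f w))"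
      by (intro add_mono cSUP_upper i bdd SC_fun_diff f g h)
    finally show "N i (\<lambda>w. h w - f w) \<le> \<dots>" .
  qed
next
  fix f :: "'n field" assume f: "f \<in> SC_fun p"
  have "(SUP i\<in>S. N i (\<lambda>w. f w - f w)) = (SUP i\<in>S. 0)"
    by (intro SUP_cong refl adapted_zero[OF N] f)
  then show "(SUP i\<in>S. N i (\<lambda>w. f w - f w)) = 0" using S by simp
next
  fix f f' g g' :: "'n field"
  assume "f \<in> SC_fun p" "f' \<in> SC_fun p" "g \<in> SC_fun p" "g' \<in> SC_fun p"
    and "(f, f') \<in> SC_eq" "(g, g') \<in> SC_eq"
  then show "(SUP i\<in>S. N i (\<lambda>w. g w - f w)) = (SUP i\<in>S. N i (\<lambda>w. g' w - f' w))"
    by (intro SUP_cong refl adapted_cong[OF N])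
qed

subsection \<open>Seminorms along bounded continuous paths\<close>

text \<open>Pairing x with a constant or with a shifted delay gives one path in the product space,
  so all five families become suprema of integrals along paths. The radius is real to allow values
  such as \<open>real j + norm v\<close>.\<close>

definition paths :: "real set \<Rightarrow> real \<Rightarrow> (real \<Rightarrow> 'a::real_normed_vector) set" where
  "paths I r = {w. continuous_on I w \<and> w ` I \<subseteq> cball 0 r}"

lemma path_measurable:
  fixes f :: "'n::finite field"
  assumes "f \<in> SC_fun p" "w \<in> paths {a..b} r"
  shows "(\<lambda>t. f (t, w t)) \<in> borel_measurable (lebesgue_on {a..b})"
proof -
  have f: "f \<in> borel_measurable borel" using assms(1) by (simp add: SC_fun_def)
  have "continuous_on {a..b} (\<lambda>t. (t, w t))"
    using assms(2) by (auto simp: paths_def intro!: continuous_intros)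
  then have "(\<lambda>t. (t, w t)) \<in> borel_measurable (lebesgue_on {a..b})"
    by (rule continuous_imp_measurable_on_sets_lebesgue) simp
  from measurable_compose[OF this f] show ?thesis .
qed

lemma AE_lebesgue_onI:
  "AE t in lebesgue. P t \<Longrightarrow> AE t in lebesgue_on {a..b::real}. P t"
  by (subst AE_restrict_space_iff) (auto elim: eventually_mono)

lemma SC_fun_dominated:
  fixes f :: "'n::finite field"
  assumes "f \<in> SC_fun p"
  obtains m where "m \<in> borel_measurable (lebesgue_on {a..b})" "\<And>t. 0 \<le> m t"
    and "integrable (lebesgue_on {a..b}) (\<lambda>t. m t ^ p)"
    and "AE t in lebesgue_on {a..b}. \<forall>z\<in>cball 0 r. norm (f (t, z)) \<le> m t"
proof -
  have "\<exists>m\<in>Lp_loc p. AE t in lebesgue. \<forall>z\<in>cball 0 r. norm (f (t, z)) \<le> m t"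
    using assms unfolding SC_fun_def by (elim CollectE conjE allE[of _ "cball 0 r"]) simp
  then obtain m where m: "m \<in> Lp_loc p" "AE t in lebesgue. \<forall>z\<in>cball 0 r. norm (f (t, z)) \<le> m t"
    by blast
  show thesis
  proof
    show "(\<lambda>t. \<bar>m t\<bar>) \<in> borel_measurable (lebesgue_on {a..b})"
      "integrable (lebesgue_on {a..b}) (\<lambda>t. \<bar>m t\<bar> ^ p)"
      using m(1) unfolding Lp_loc_def by (simp_all add: borel_measurable_abs)
    have "AE t in lebesgue_on {a..b}. \<forall>z\<in>cball 0 r. norm (f (t, z)) \<le> m t"
      using m(2) by (rule AE_lebesgue_onI)
    then show "AE t in lebesgue_on {a..b}. \<forall>z\<in>cball 0 r. norm (f (t, z)) \<le> \<bar>m t\<bar>"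
      by (rule eventually_mono) force
  qed simp
qed

text \<open>The quantifier over z stands inside the almost-everywhere quantifier: one null set
  serves all z, so the moving point \<open>w t\<close> may be inserted.\<close>

lemma AE_path:
  assumes "AE t in lebesgue_on {a..b}. \<forall>z\<in>cball 0 r. P t z" "w \<in> paths {a..b} r"
  shows "AE t in lebesgue_on {a..b}. P t (w t)"
  using assms(1) AE_space
proof eventually_elim
  case (elim t)
  then have "w t \<in> cball 0 r" using assms(2) unfolding paths_def by (simp add: image_subset_iff)
  then show ?case using elim(1) by blast
qed

lemma path_integrable_power:
  fixes f :: "'n::finite field"
  assumes "f \<in> SC_fun p" "w \<in> paths {a..b} r"
  shows "integrable (lebesgue_on {a..b}) (\<lambda>t. norm (f (t, w t)) ^ p)"
proof -
  obtain m where "m \<in> borel_measurable (lebesgue_on {a..b})" "\<And>t. 0 \<le> m t"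
    and m: "integrable (lebesgue_on {a..b}) (\<lambda>t. m t ^ p)"
      "AE t in lebesgue_on {a..b}. \<forall>z\<in>cball 0 r. norm (f (t, z)) \<le> m t"
    by (rule SC_fun_dominated[OF assms(1), where a = a and b = b and r = r]) blast
  show ?thesis
    by (rule integrable_power_bound[OF path_measurable[OF assms] m(1) AE_path[OF m(2) assms(2)]])
qed

lemma path_integrable:
  fixes f :: "'n::finite field"
  assumes "f \<in> SC_fun 1" "w \<in> paths {a..b} r"
  shows "integrable (lebesgue_on {a..b}) (\<lambda>t. f (t, w t))"
  using path_integrable_power[OF assms] path_measurable[OF assms]
  by (simp add: integrable_norm_iff)

lemma SC_eq_path:
  fixes f f' g g' :: "'n::finite field"
  assumes "(f, f') \<in> SC_eq" "(g, g') \<in> SC_eq"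
  shows "AE t in lebesgue_on {a..b}. g (t, w t) - f (t, w t) = g' (t, w t) - f' (t, w t)"
  using AE_lebesgue_onI[OF SC_eq_AE_slices[OF assms(1)]] AE_lebesgue_onI[OF SC_eq_AE_slices[OF assms(2)]]
  by eventually_elim metis

definition path_norm :: "nat \<Rightarrow> real set \<Rightarrow> (real \<Rightarrow> (real ^ 'n) \<times> (real ^ 'n)) \<Rightarrow> ('n::finite) field \<Rightarrow> real" where
  "path_norm p I w f = root p (LINT t|lebesgue_on I. norm (f (t, w t)) ^ p)"

definition path_mean :: "real set \<Rightarrow> (real \<Rightarrow> (real ^ 'n) \<times> (real ^ 'n)) \<Rightarrow> ('n::finite) field \<Rightarrow> real" where
  "path_mean I w f = norm (LINT t|lebesgue_on I. f (t, w t))"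

lemma adapted_path_norm:
  fixes w :: "real \<Rightarrow> (real ^ 'n::finite) \<times> (real ^ 'n)"
  assumes p: "1 \<le> p" and w: "w \<in> paths {a..b} r"
  shows "adapted p (path_norm p {a..b} w)"
  unfolding adapted_def
proof (intro conjI ballI impI)
  fix f :: "'n field" assume "f \<in> SC_fun p"
  show "path_norm p {a..b} w (\<lambda>w. f w - f w) = 0"
    using p by (simp add: path_norm_def)
next
  fix f g h :: "'n field" assume f: "f \<in> SC_fun p" and g: "g \<in> SC_fun p" and h: "h \<in> SC_fun p"
  let ?M = "lebesgue_on {a..b}"
  let ?A = "\<lambda>t. norm (h (t, w t) - g (t, w t))" and ?B = "\<lambda>t. norm (g (t, w t) - f (t, w t))"
  note d = path_measurable[OF SC_fun_diff w] path_integrable_power[OF SC_fun_diff w]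
  have A: "?A \<in> borel_measurable ?M" "integrable ?M (\<lambda>t. ?A t ^ p)"
    using d[OF g h] by auto
  have B: "?B \<in> borel_measurable ?M" "integrable ?M (\<lambda>t. ?B t ^ p)"
    using d[OF f g] by auto
  have "path_norm p {a..b} w (\<lambda>w. h w - f w) \<le> root p (LINT t|?M. (?A t + ?B t) ^ p)"
    unfolding path_norm_def
  proof (rule root_integral_mono[OF p d(1)[OF f h]])
    show "integrable ?M (\<lambda>t. (?A t + ?B t) ^ p)"
      by (rule integrable_add_power) (use A B in auto)
    show "AE t in ?M. norm (h (t, w t) - f (t, w t)) \<le> ?A t + ?B t"
      by (intro AE_I2 norm_diff_triangle_le[OF order_refl order_refl])
  qed
  also have "\<dots> \<le> path_norm p {a..b} w (\<lambda>w. h w - g w) + path_norm p {a..b} w (\<lambda>w. g w - f w)"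
    unfolding path_norm_def by (rule Minkowski_add[OF p]) (use A B in auto)
  finally show "path_norm p {a..b} w (\<lambda>w. h w - f w)
      \<le> path_norm p {a..b} w (\<lambda>w. h w - g w) + path_norm p {a..b} w (\<lambda>w. g w - f w)" .
next
  fix f f' g g' :: "'n field"
  assume fg: "f \<in> SC_fun p" "f' \<in> SC_fun p" "g \<in> SC_fun p" "g' \<in> SC_fun p"
    and eq: "(f, f') \<in> SC_eq" "(g, g') \<in> SC_eq"
  note d = path_measurable[OF SC_fun_diff w]
  have "(LINT t|lebesgue_on {a..b}. norm (g (t, w t) - f (t, w t)) ^ p)
      = (LINT t|lebesgue_on {a..b}. norm (g' (t, w t) - f' (t, w t)) ^ p)"
  proof (rule integral_cong_AE)
    show "AE t in lebesgue_on {a..b}. norm (g (t, w t) - f (t, w t)) ^ p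
        = norm (g' (t, w t) - f' (t, w t)) ^ p"
      using SC_eq_path[OF eq, where a = a and b = b and w = w] by eventually_elim simp
  qed (use d[OF fg(1,3)] d[OF fg(2,4)] in auto)
  then show "path_norm p {a..b} w (\<lambda>w. g w - f w) = path_norm p {a..b} w (\<lambda>w. g' w - f' w)"
    by (simp add: path_norm_def)
qed

lemma adapted_path_mean:
  fixes w :: "real \<Rightarrow> (real ^ 'n::finite) \<times> (real ^ 'n)"
  assumes w: "w \<in> paths {a..b} r"
  shows "adapted 1 (path_mean {a..b} w)"
  unfolding adapted_def
proof (intro conjI ballI impI)
  fix f :: "'n field" assume "f \<in> SC_fun 1"
  show "path_mean {a..b} w (\<lambda>w. f w - f w) = 0"
    by (simp add: path_mean_def)
next
  fix f g h :: "'n field" assume fgh: "f \<in> SC_fun 1" "g \<in> SC_fun 1" "h \<in> SC_fun 1"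
  note i = path_integrable[OF _ w]
  have "(LINT t|lebesgue_on {a..b}. h (t, w t) - f (t, w t))
      = (LINT t|lebesgue_on {a..b}. h (t, w t) - g (t, w t))
        + (LINT t|lebesgue_on {a..b}. g (t, w t) - f (t, w t))"
    using i[OF fgh(1)] i[OF fgh(2)] i[OF fgh(3)] by simp
  then show "path_mean {a..b} w (\<lambda>w. h w - f w)
      \<le> path_mean {a..b} w (\<lambda>w. h w - g w) + path_mean {a..b} w (\<lambda>w. g w - f w)"
    unfolding path_mean_def by (simp add: norm_triangle_ineq)
next
  fix f f' g g' :: "'n field"
  assume fg: "f \<in> SC_fun 1" "f' \<in> SC_fun 1" "g \<in> SC_fun 1" "g' \<in> SC_fun 1"
    and eq: "(f, f') \<in> SC_eq" "(g, g') \<in> SC_eq"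
  note d = path_measurable[OF SC_fun_diff w]
  have "(LINT t|lebesgue_on {a..b}. g (t, w t) - f (t, w t))
      = (LINT t|lebesgue_on {a..b}. g' (t, w t) - f' (t, w t))"
    by (intro integral_cong_AE SC_eq_path[OF eq] d[OF fg(1,3)] d[OF fg(2,4)])
  then show "path_mean {a..b} w (\<lambda>w. g w - f w) = path_mean {a..b} w (\<lambda>w. g' w - f' w)"
    by (simp add: path_mean_def)
qed

text \<open>All the paths stay in one ball, so a single dominating function bounds every
  norm.\<close>

lemma bdd_above_path_norm:
  fixes f :: "'n::finite field"
  assumes p: "1 \<le> p" and f: "f \<in> SC_fun p" and W: "\<And>i. i \<in> S \<Longrightarrow> W i \<in> paths {a..b} r"
  shows "bdd_above ((\<lambda>i. path_norm p {a..b} (W i) f) ` S)"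
proof -
  obtain m where "m \<in> borel_measurable (lebesgue_on {a..b})" "\<And>t. 0 \<le> m t"
    and m: "integrable (lebesgue_on {a..b}) (\<lambda>t. m t ^ p)"
      "AE t in lebesgue_on {a..b}. \<forall>z\<in>cball 0 r. norm (f (t, z)) \<le> m t"
    by (rule SC_fun_dominated[OF f, where a = a and b = b and r = r]) blast
  have le: "path_norm p {a..b} (W i) f \<le> root p (LINT t|lebesgue_on {a..b}. m t ^ p)" if "i \<in> S" for i
    unfolding path_norm_def
    by (rule root_integral_mono[OF p path_measurable[OF f W[OF that]] m(1) AE_path[OF m(2) W[OF that]]])
  then show ?thesis by (rule bdd_aboveI2)
qed

lemma path_mean_le_path_norm:
  fixes f :: "'n::finite field"
  assumes f: "f \<in> SC_fun 1" and w: "w \<in> paths {a..b} r"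
  shows "path_mean {a..b} w f \<le> path_norm 1 {a..b} w f"
  using integral_norm_bound[of "lebesgue_on {a..b}" "\<lambda>t. f (t, w t)"]
  by (simp add: path_mean_def path_norm_def)

lemma bdd_above_path_mean:
  fixes f :: "'n::finite field"
  assumes f: "f \<in> SC_fun 1" and W: "\<And>i. i \<in> S \<Longrightarrow> W i \<in> paths {a..b} r"
  shows "bdd_above ((\<lambda>i. path_mean {a..b} (W i) f) ` S)"
proof -
  have "path_mean {a..b} (W i) f \<le> (SUP i\<in>S. path_norm 1 {a..b} (W i) f)" if "i \<in> S" for i
  proof -
    have "path_mean {a..b} (W i) f \<le> path_norm 1 {a..b} (W i) f"
      by (rule path_mean_le_path_norm[OF f W[OF that]])
    also have "\<dots> \<le> (SUP i\<in>S. path_norm 1 {a..b} (W i) f)"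
      by (intro cSUP_upper that bdd_above_path_norm[OF order_refl f W])
    finally show ?thesis .
  qed
  then show ?thesis by (rule bdd_aboveI2)
qed

lemma SC_fun_const_measurable:
  fixes f :: "'n::finite field"
  assumes "f \<in> SC_fun p"
  shows "(\<lambda>t. f (t, z)) \<in> borel_measurable (lebesgue_on {a..b})"
  using path_measurable[OF assms, where w = "\<lambda>_. z" and a = a and b = b and r = "norm z"]
  by (simp add: paths_def image_subset_iff)

subsection \<open>Modulus of continuity of a Caratheodory function in the mean\<close>

text \<open>
  The supremum is taken over a countable dense set of pairs to make it measurable; as the
  distance bound 1/(n+1) shrinks it tends to zero, by uniform continuity on compact sets, and
  dominated convergence applies.
\<close>

lemma SC_fun_modulus:
  fixes f :: "'n::finite field"
  assumes p: "1 \<le> p" and f: "f \<in> SC_fun p" and e: "0 < e"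
  obtains d \<omega> where "0 < d" "\<omega> \<in> borel_measurable (lebesgue_on {a..b})" "\<And>t. 0 \<le> \<omega> t"
    and "integrable (lebesgue_on {a..b}) (\<lambda>t. \<omega> t ^ p)"
    and "root p (LINT t|lebesgue_on {a..b}. \<omega> t ^ p) < e"
    and "AE t in lebesgue_on {a..b}. \<forall>z\<in>cball 0 r. \<forall>z'\<in>cball 0 r. dist z z' < d \<longrightarrow>
           norm (f (t, z) - f (t, z')) \<le> \<omega> t"
proof -
  let ?M = "lebesgue_on {a..b}"
  define S :: "nat \<Rightarrow> (((real ^ 'n) \<times> (real ^ 'n)) \<times> ((real ^ 'n) \<times> (real ^ 'n))) set" where
    "S n = {q. fst q \<in> cball 0 r \<and> snd q \<in> cball 0 r \<and> dist (fst q) (snd q) < 1 / real (Suc n)}" for n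
  have "\<exists>T. countable T \<and> T \<subseteq> S n \<and> S n \<subseteq> closure T" for n
    using separable[of "S n"] by metis
  then obtain T where T: "\<And>n. countable (T n)" "\<And>n. T n \<subseteq> S n" "\<And>n. S n \<subseteq> closure (T n)"
    by metis
  \<comment> \<open>In the extended reals the supremum exists without a boundedness condition. For
    almost every t it is finite, namely at most \<open>2 * m t\<close>.\<close>
  define om :: "nat \<Rightarrow> real \<Rightarrow> ennreal" where
    "om n t = (SUP q\<in>T n. ennreal (norm (f (t, fst q) - f (t, snd q))))" for n t
  define \<omega> where "\<omega> n t = enn2real (om n t)" for n t
  obtain m where m: "m \<in> borel_measurable ?M" "\<And>t. 0 \<le> m t" "integrable ?M (\<lambda>t. m t ^ p)"
      "AE t in ?M. \<forall>z\<in>cball 0 r. norm (f (t, z)) \<le> m t"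
    by (rule SC_fun_dominated[OF f, where a = a and b = b and r = r]) blast
  have meas: "\<omega> n \<in> borel_measurable ?M" for n
  proof -
    note [measurable] = SC_fun_const_measurable[OF f, where a = a and b = b]
    have "om n \<in> borel_measurable ?M"
      unfolding om_def using T(1) by (intro borel_measurable_SUP) measurable
    then show ?thesis unfolding \<omega>_def by measurable
  qed
  have cont: "AE t in ?M. continuous_on UNIV (\<lambda>z. f (t, z))"
    by (rule AE_lebesgue_onI) (use f in \<open>simp add: SC_fun_def\<close>)
  have om_le: "om n t \<le> ennreal c"
    if "\<And>z z'. z \<in> cball 0 r \<Longrightarrow> z' \<in> cball 0 r \<Longrightarrow> dist z z' < 1 / real (Suc n) \<Longrightarrow>
         norm (f (t, z) - f (t, z')) \<le> c" for n t c
    unfolding om_def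
  proof (rule SUP_least)
    fix q assume "q \<in> T n"
    then have "q \<in> S n" using T(2) by blast
    then have "norm (f (t, fst q) - f (t, snd q)) \<le> c"
      using that[of "fst q" "snd q"] by (simp add: S_def)
    then show "ennreal (norm (f (t, fst q) - f (t, snd q))) \<le> ennreal c" by (rule ennreal_leI)
  qed
  have bound: "om n t \<le> ennreal (2 * m t)" if "\<forall>z\<in>cball 0 r. norm (f (t, z)) \<le> m t" for n t
  proof (rule om_le)
    fix z z' :: "(real ^ 'n) \<times> (real ^ 'n)" assume "z \<in> cball 0 r" "z' \<in> cball 0 r"
    then have "norm (f (t, z)) \<le> m t" "norm (f (t, z')) \<le> m t" using that by auto
    then show "norm (f (t, z) - f (t, z')) \<le> 2 * m t"
      using norm_triangle_ineq4[of "f (t, z)" "f (t, z')"] by linarith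
  qed
  have \<omega>_le: "\<omega> n t \<le> c" if "om n t \<le> ennreal c" "0 \<le> c" for n t c
    using enn2real_mono[OF that(1)] that(2) by (simp add: \<omega>_def)
  have conv: "AE t in ?M. (\<lambda>n. \<omega> n t ^ p) \<longlonglongrightarrow> 0"
    using cont
  proof eventually_elim
    case (elim t)
    have uc: "uniformly_continuous_on (cball 0 r) (\<lambda>z. f (t, z))"
      by (intro compact_uniformly_continuous continuous_on_subset[OF elim]) auto
    have "(\<lambda>n. \<omega> n t) \<longlonglongrightarrow> 0"
    proof (rule LIMSEQ_I)
      fix s :: real assume "s > 0"
      then obtain d where d: "d > 0" and ucd: "\<And>z z'. z \<in> cball 0 r \<Longrightarrow> z' \<in> cball 0 r \<Longrightarrow>
          dist z' z < d \<Longrightarrow> dist (f (t, z')) (f (t, z)) < s / 2"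
        using uc unfolding uniformly_continuous_on_def by (meson half_gt_zero)
      obtain k where k: "1 / real (Suc k) < d" using d by (meson nat_approx_posE)
      have "norm (\<omega> n t - 0) < s" if "n \<ge> k" for n
      proof -
        have "1 / real (Suc n) \<le> 1 / real (Suc k)" using that by (simp add: frac_le)
        then have "om n t \<le> ennreal (s / 2)"
          using k ucd by (intro om_le) (force simp: dist_norm norm_minus_commute)
        then have "\<omega> n t \<le> s / 2" using \<open>s > 0\<close> by (intro \<omega>_le) auto
        then show ?thesis using \<open>s > 0\<close> by (simp add: \<omega>_def)
      qed
      then show "\<exists>k. \<forall>n\<ge>k. norm (\<omega> n t - 0) < s" by blast
    qed
    from tendsto_power[OF this, of p] show ?case using p by (simp add: power_0_left)
  qed
  have dom: "AE t in ?M. norm (\<omega> n t ^ p) \<le> 2 ^ p * m t ^ p" for n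
    using m(4)
  proof eventually_elim
    case (elim t)
    have "\<omega> n t \<le> 2 * m t" using bound[OF elim] m(2) by (intro \<omega>_le) auto
    then have "\<omega> n t ^ p \<le> (2 * m t) ^ p" by (intro power_mono) (auto simp: \<omega>_def)
    then show ?case by (simp add: \<omega>_def power_mult_distrib)
  qed
  have int: "integrable ?M (\<lambda>t. 2 ^ p * m t ^ p)" using m(3) by simp
  have mp: "(\<lambda>t. \<omega> n t ^ p) \<in> borel_measurable ?M" for n
    using meas by (rule borel_measurable_power)
  have int\<omega>: "integrable ?M (\<lambda>t. \<omega> n t ^ p)" for n
    by (rule integrable_dominated_convergence2[OF borel_measurable_const mp int conv dom])
  have "(\<lambda>n. LINT t|?M. \<omega> n t ^ p) \<longlonglongrightarrow> (LINT t|?M. 0)"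
    by (rule integral_dominated_convergence[OF borel_measurable_const mp int conv dom])
  then have lim: "(\<lambda>n. LINT t|?M. \<omega> n t ^ p) \<longlonglongrightarrow> 0" by simp
  have "(\<lambda>n. root p (LINT t|?M. \<omega> n t ^ p)) \<longlonglongrightarrow> root p 0"
    using lim by (rule tendsto_real_root)
  then have "\<forall>\<^sub>F n in sequentially. root p (LINT t|?M. \<omega> n t ^ p) < e"
    using e by (intro order_tendstoD(2)) auto
  then obtain n where n: "root p (LINT t|?M. \<omega> n t ^ p) < e"
    using eventually_happens by fastforce
  have "AE t in ?M. \<forall>z\<in>cball 0 r. \<forall>z'\<in>cball 0 r. dist z z' < 1 / real (Suc n) \<longrightarrow>
           norm (f (t, z) - f (t, z')) \<le> \<omega> n t"
    using cont m(4)
  proof eventually_elim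
    case (elim t)
    have fin: "om n t < \<infinity>"
      using bound[OF elim(2)] by (rule le_less_trans) simp
    have "T n \<subseteq> {q. norm (f (t, fst q) - f (t, snd q)) \<le> \<omega> n t}"
    proof
      fix q assume "q \<in> T n"
      then have "ennreal (norm (f (t, fst q) - f (t, snd q))) \<le> om n t"
        unfolding om_def by (rule SUP_upper)
      also have "\<dots> = ennreal (\<omega> n t)" using fin by (simp add: \<omega>_def)
      finally show "q \<in> {q. norm (f (t, fst q) - f (t, snd q)) \<le> \<omega> n t}"
        by (simp add: \<omega>_def ennreal_le_iff)
    qed
    \<comment> \<open>By continuity in z the admissible pairs form a closed set. It contains the
      dense subset \<open>T n\<close> and therefore all of \<open>S n\<close>.\<close>
    moreover have "closed {q. norm (f (t, fst q) - f (t, snd q)) \<le> \<omega> n t}"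
      by (intro closed_Collect_le continuous_intros continuous_on_compose2[OF elim(1)]) auto
    ultimately have "S n \<subseteq> {q. norm (f (t, fst q) - f (t, snd q)) \<le> \<omega> n t}"
      using T(3)[of n] closure_minimal by blast
    then show ?case by (auto simp: S_def subset_iff)
  qed
  then show thesis
    by (intro that[of "1 / real (Suc n)" "\<omega> n"]) (use meas int\<omega> n in \<open>auto simp: \<omega>_def\<close>)
qed

section \<open>Uniform l2-bounds and finite nets\<close>

text \<open>Turns the extended-valued bounds on symmetric windows into real data on a given
  interval: each g has its own Lipschitz factor L, while the bound C on the integrals of the powers
  is common to E.\<close>

lemma bounded_l2_boundsD:
  fixes E :: "('n::finite) field set set"
  assumes bd: "bounded_l2_bounds p q E"
  obtains C where "0 \<le> C"
    and "\<And>g. g \<in> \<Union>E \<Longrightarrow> \<exists>L. L \<in> borel_measurable (lebesgue_on {a..b}) \<and> (\<forall>t. 0 \<le> L t) \<and>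
        integrable (lebesgue_on {a..b}) (\<lambda>t. L t ^ q) \<and> (LINT t|lebesgue_on {a..b}. L t ^ q) \<le> C \<and>
        (AE t in lebesgue_on {a..b}. \<forall>x u v. (x, u) \<in> cball 0 (real j) \<longrightarrow> (x, v) \<in> cball 0 (real j) \<longrightarrow>
           norm (g (t, x, u) - g (t, x, v)) \<le> L t * norm (u - v))"
proof -
  \<comment> \<open>Large enough for the window \<open>{-r..r}\<close> to contain
    \<open>{a..b}\<close>; the summand 1 keeps r positive.\<close>
  define r where "r = \<bar>a\<bar> + \<bar>b\<bar> + 1"
  have r: "r > 0" "{a..b} \<subseteq> {-r..r}" by (auto simp: r_def)
  let ?M = "lebesgue_on {a..b}"
  define C where "C = (SUP f\<in>\<Union>E. \<integral>\<^sup>+ t. l2_bound f j t ^ q \<partial>lebesgue_on {-r..r})"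
  have C: "C < \<infinity>" using bd r(1) unfolding bounded_l2_bounds_def C_def by blast
  show thesis
  proof (rule that[of "enn2real C"])
    fix g assume g: "g \<in> \<Union>E"
    define L where "L t = enn2real (l2_bound g j t)" for t
    have L0: "0 \<le> L t" for t by (simp add: L_def)
    have fin: "AE t in lebesgue. l2_bound g j t < \<infinity>" and LLp: "L \<in> Lp_loc p"
      using bd g unfolding bounded_l2_bounds_def L_def[abs_def] by blast+
    have Lm: "L \<in> borel_measurable ?M" using LLp by (simp add: Lp_loc_def)
    have fin': "AE t in ?M. l2_bound g j t = ennreal (L t)"
      using AE_lebesgue_onI[OF fin] by eventually_elim (simp add: L_def)
    have "(\<integral>\<^sup>+ t. ennreal (L t ^ q) \<partial>?M) = (\<integral>\<^sup>+ t. l2_bound g j t ^ q \<partial>?M)"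
    proof (rule nn_integral_cong_AE)
      show "AE t in ?M. ennreal (L t ^ q) = l2_bound g j t ^ q"
        using fin'
      proof eventually_elim
        case (elim t)
        show ?case unfolding elim by (rule ennreal_power[symmetric]) (simp add: L_def)
      qed
    qed
    also have "\<dots> \<le> (\<integral>\<^sup>+ t. l2_bound g j t ^ q \<partial>lebesgue_on {-r..r})"
      using r(2) by (subst (1 2) nn_integral_restrict_space)
        (auto intro!: nn_integral_mono simp: indicator_def)
    also have "\<dots> \<le> C" unfolding C_def using g by (intro SUP_upper)
    finally have le: "(\<integral>\<^sup>+ t. ennreal (L t ^ q) \<partial>?M) \<le> C" .
    have "integrable ?M (\<lambda>t. L t ^ q)"
      using Lm le C by (intro integrableI_nonneg) (auto simp: L0)
    moreover have "(LINT t|?M. L t ^ q) \<le> enn2real C"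
    proof -
      have "(LINT t|?M. L t ^ q) = enn2real (\<integral>\<^sup>+ t. ennreal (L t ^ q) \<partial>?M)"
        using Lm by (intro integral_eq_nn_integral) (auto simp: L0)
      also have "\<dots> \<le> enn2real C" using le C by (intro enn2real_mono) auto
      finally show ?thesis .
    qed
    moreover have "AE t in ?M. \<forall>x u v. (x, u) \<in> cball 0 (real j) \<longrightarrow> (x, v) \<in> cball 0 (real j) \<longrightarrow>
           norm (g (t, x, u) - g (t, x, v)) \<le> L t * norm (u - v)"
      using fin'
    proof eventually_elim
      case (elim t)
      show ?case
      proof (intro allI impI)
        fix x u v :: "real ^ 'n" assume xuv: "(x, u) \<in> cball 0 (real j)" "(x, v) \<in> cball 0 (real j)"
        show "norm (g (t, x, u) - g (t, x, v)) \<le> L t * norm (u - v)"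
        proof (cases "u = v")
          case False
          have "ennreal (norm (g (t, x, u) - g (t, x, v)) / norm (u - v)) \<le> l2_bound g j t"
            unfolding l2_bound_def by (rule SUP_upper2[of "(x, u, v)"]) (use xuv False in auto)
          then have "norm (g (t, x, u) - g (t, x, v)) / norm (u - v) \<le> L t"
            unfolding elim by (simp add: L_def ennreal_le_iff)
          then show ?thesis using False by (simp add: pos_divide_le_eq)
        qed simp
      qed
    qed
    ultimately show "\<exists>L. L \<in> borel_measurable ?M \<and> (\<forall>t. 0 \<le> L t) \<and>
        integrable ?M (\<lambda>t. L t ^ q) \<and> (LINT t|?M. L t ^ q) \<le> enn2real C \<and>
        (AE t in ?M. \<forall>x u v. (x, u) \<in> cball 0 (real j) \<longrightarrow> (x, v) \<in> cball 0 (real j) \<longrightarrow>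
           norm (g (t, x, u) - g (t, x, v)) \<le> L t * norm (u - v))"
      using Lm L0 by (intro exI[of _ L]) blast
  qed simp
qed

lemma finite_net_from_dense:
  fixes D :: "'a::euclidean_space set"
  assumes "closure D = UNIV" and d: "0 < d"
  obtains V where "finite V" "V \<subseteq> D" "\<And>v. v \<in> V \<Longrightarrow> norm v \<le> r + d"
    and "\<And>u. u \<in> cball 0 r \<Longrightarrow> \<exists>v\<in>V. norm (u - v) < d"
proof -
  have cov: "cball 0 r \<subseteq> (\<Union>v\<in>D. ball v d)"
  proof
    fix u :: 'a
    have "u \<in> closure D" using assms(1) by simp
    then obtain v where "v \<in> D" "dist v u < d" using d by (meson closure_approachable)
    then show "u \<in> (\<Union>v\<in>D. ball v d)" by auto
  qed
  obtain V where V: "V \<subseteq> D" "finite V" "cball 0 r \<subseteq> (\<Union>v\<in>V. ball v d)"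
    by (rule compactE_image[OF compact_cball _ cov]) auto
  show thesis
  proof
    \<comment> \<open>Of a finite subcover only the centres of norm at most r + d are kept. A centre
      within d of a point of the ball satisfies this automatically, so the net property
      survives.\<close>
    show "finite {v \<in> V. norm v \<le> r + d}" "{v \<in> V. norm v \<le> r + d} \<subseteq> D" using V by auto
    fix u :: 'a assume u: "u \<in> cball 0 r"
    then obtain v where v: "v \<in> V" "norm (u - v) < d"
      using V(3) by (force simp: dist_norm norm_minus_commute)
    moreover have "norm v \<le> r + d"
      using norm_triangle_ineq2[of v u] v u by (simp add: norm_minus_commute)
    ultimately show "\<exists>v\<in>{v \<in> V. norm v \<le> r + d}. norm (u - v) < d" by blast
  qed auto
qed

subsection \<open>Controlling the stronger seminorms\<close>

lemma Pair_path:
  assumes "x \<in> C_ball {a..b} j" "continuous_on {a..b} y" "\<And>t. t \<in> {a..b} \<Longrightarrow> norm (y t) \<le> s"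
    and "real j + s \<le> r"
  shows "(\<lambda>t. (x t, y t)) \<in> paths {a..b} r"
proof -
  have "norm (x t, y t) \<le> r" if "t \<in> {a..b}" for t
  proof -
    have "norm (x t) \<le> real j" using assms(1) that by (auto simp: C_ball_def image_subset_iff)
    then show ?thesis using norm_Pair_le[of "x t" "y t"] assms(3)[OF that] assms(4) by linarith
  qed
  then show ?thesis using assms(1,2)
    by (auto simp: paths_def C_ball_def intro!: continuous_on_Pair)
qed

lemma C_ball_shift:
  assumes "u \<in> C_ball (shift {a..b}) j"
  shows "continuous_on {a..b} (\<lambda>t. u (t - 1))" "\<And>t. t \<in> {a..b} \<Longrightarrow> norm (u (t - 1)) \<le> real j"
proof -
  show "continuous_on {a..b} (\<lambda>t. u (t - 1))"
    using assms unfolding C_ball_def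
    by (intro continuous_on_compose2[where g = u and s = "{a..b}" and t = "shift {a..b}"] continuous_intros) auto
  show "norm (u (t - 1)) \<le> real j" if "t \<in> {a..b}" for t
    using assms that unfolding C_ball_def by (auto simp: image_subset_iff)
qed

lemma difference_bound:
  fixes f g :: "'n::finite field"
  assumes g: "norm (g (t, x, u) - g (t, x, v)) \<le> L * norm (u - v)"
    and f: "norm (f (t, x, u) - f (t, x, v)) \<le> w"
    and "norm (u - v) \<le> d" "0 \<le> L"
  shows "norm ((g (t, x, u) - f (t, x, u)) - (g (t, x, v) - f (t, x, v))) \<le> d * L + w"
proof -
  have "norm ((g (t, x, u) - f (t, x, u)) - (g (t, x, v) - f (t, x, v)))
      \<le> norm (g (t, x, u) - g (t, x, v)) + norm (f (t, x, u) - f (t, x, v))"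
    using norm_triangle_ineq4[of "g (t, x, u) - g (t, x, v)" "f (t, x, u) - f (t, x, v)"]
    by (simp add: algebra_simps)
  moreover have "L * norm (u - v) \<le> d * L"
    using mult_left_mono[OF assms(3,4)] by (simp add: mult.commute)
  ultimately show ?thesis using f g by linarith
qed

text \<open>V and d are found before g, x and u, so that the supremum over x and u is controlled by
  finitely many seminorms uniformly over E.\<close>

lemma path_norm_control:
  fixes f :: "'n::finite field" and E :: "'n field set set"
  assumes p: "1 \<le> p" and E: "E \<subseteq> SC p" and bd: "bounded_l2_bounds p p E"
    and D: "closure D = UNIV" and f: "f \<in> SC_fun p" and e: "0 < e"
  obtains V d where "finite V" "V \<subseteq> D" "0 < d"
    and "\<And>g x u. g \<in> \<Union>E \<Longrightarrow> x \<in> C_ball {a..b} j \<Longrightarrow> u \<in> C_ball (shift {a..b}) j \<Longrightarrow>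
      (\<And>v. v \<in> V \<Longrightarrow> path_norm p {a..b} (\<lambda>t. (x t, v)) (\<lambda>w. g w - f w) \<le> d) \<Longrightarrow>
      path_norm p {a..b} (\<lambda>t. (x t, u (t - 1))) (\<lambda>w. g w - f w) \<le> e"
proof -
  let ?M = "lebesgue_on {a..b}"
  \<comment> \<open>x has norm at most j and net points have norm at most j + 1, so all pairs lie in
    the ball of radius 2 * j + 1. This is a natural number, as the index of an l2-bound has to
    be.\<close>
  define r where "r = real (2 * j + 1)"
  obtain d0 \<omega> where d0: "0 < d0" and \<omega>: "\<omega> \<in> borel_measurable ?M" "\<And>t. 0 \<le> \<omega> t"
    "integrable ?M (\<lambda>t. \<omega> t ^ p)" "root p (LINT t|?M. \<omega> t ^ p) < e / 4"
    and \<omega>f: "AE t in ?M. \<forall>z\<in>cball 0 r. \<forall>z'\<in>cball 0 r. dist z z' < d0 \<longrightarrow>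
           norm (f (t, z) - f (t, z')) \<le> \<omega> t"
    by (rule SC_fun_modulus[OF p f, where e = "e / 4" and a = a and b = b and r = r])
      (use e in auto)
  obtain C where C: "0 \<le> C" and CL: "\<And>g. g \<in> \<Union>E \<Longrightarrow> \<exists>L. L \<in> borel_measurable ?M \<and> (\<forall>t. 0 \<le> L t) \<and>
        integrable ?M (\<lambda>t. L t ^ p) \<and> (LINT t|?M. L t ^ p) \<le> C \<and>
        (AE t in ?M. \<forall>x u v. (x, u) \<in> cball 0 (real (2 * j + 1)) \<longrightarrow> (x, v) \<in> cball 0 (real (2 * j + 1)) \<longrightarrow>
           norm (g (t, x, u) - g (t, x, v)) \<le> L t * norm (u - v))"
    by (rule bounded_l2_boundsD[OF bd, where a = a and b = b and j = "2 * j + 1"]) blast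
  define K where "K = root p C"
  have K: "0 \<le> K" using C p by (simp add: K_def)
  \<comment> \<open>\<open>d0\<close> is the range of the modulus of f, 1 keeps the net within the
    ball of radius r, and the third entry makes the l2-contribution d * K at most e / 4. The
    denominator with K + 1 is positive even for K = 0.\<close>
  define d where "d = min d0 (min 1 (e / (4 * (K + 1))))"
  have d: "0 < d" "d \<le> d0" "d \<le> 1" using d0 e K by (auto simp: d_def)
  have dK: "d * K \<le> e / 4"
  proof -
    have "d * K \<le> e / (4 * (K + 1)) * (K + 1)"
      using K d by (intro mult_mono) (auto simp: d_def)
    also have "\<dots> = e / 4" using K by (simp add: field_simps)
    finally show ?thesis .
  qed
  obtain V where V: "finite V" "V \<subseteq> D" "\<And>v. v \<in> V \<Longrightarrow> norm v \<le> real j + d"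
    and net: "\<And>u. u \<in> cball 0 (real j) \<Longrightarrow> \<exists>v\<in>V. norm (u - v) < d"
    by (rule finite_net_from_dense[OF D d(1), where r = "real j"]) blast
  \<comment> \<open>The tolerances of all net points together stay below e / 4.\<close>
  define d' where "d' = e / (4 * (real (card V) + 1))"
  have d': "0 < d'" "real (card V) * d' \<le> e / 4" using e by (auto simp: d'_def field_simps)
  show thesis
  proof (rule that[OF V(1,2) d'(1)])
    fix g :: "'n field" and x u :: "real \<Rightarrow> real ^ 'n"
    assume g: "g \<in> \<Union>E" and x: "x \<in> C_ball {a..b} j" and u: "u \<in> C_ball (shift {a..b}) j"
      and small: "\<And>v. v \<in> V \<Longrightarrow> path_norm p {a..b} (\<lambda>t. (x t, v)) (\<lambda>w. g w - f w) \<le> d'"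
    define h where "h w = g w - f w" for w
    have "g \<in> SC_fun p" using g E SC_class(2)[OF p] by blast
    then have h: "h \<in> SC_fun p" unfolding h_def[abs_def] using f by (intro SC_fun_diff)
    have wu: "(\<lambda>t. (x t, u (t - 1))) \<in> paths {a..b} r"
      by (rule Pair_path[OF x C_ball_shift[OF u]]) (auto simp: r_def)
    have wv: "(\<lambda>t. (x t, v)) \<in> paths {a..b} r" if "v \<in> V" for v
      by (rule Pair_path[OF x, where s = "real j + d"]) (use V(3)[OF that] d in \<open>auto simp: r_def\<close>)
    obtain L where L: "L \<in> borel_measurable ?M" "\<And>t. 0 \<le> L t"
        "integrable ?M (\<lambda>t. L t ^ p)" "(LINT t|?M. L t ^ p) \<le> C"
      and Lg: "AE t in ?M. \<forall>x u v. (x, u) \<in> cball 0 (real (2 * j + 1)) \<longrightarrow> (x, v) \<in> cball 0 (real (2 * j + 1)) \<longrightarrow>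
           norm (g (t, x, u) - g (t, x, v)) \<le> L t * norm (u - v)"
      using CL[OF g] by blast
    let ?H = "\<lambda>v t. norm (h (t, x t, v))"
    let ?S = "\<lambda>t. \<Sum>v\<in>V. ?H v t"
    have Hm: "?H v \<in> borel_measurable ?M" "integrable ?M (\<lambda>t. ?H v t ^ p)" if "v \<in> V" for v
      using path_measurable[OF h wv[OF that]] path_integrable_power[OF h wv[OF that]] by auto
    have S: "?S \<in> borel_measurable ?M" "\<And>t. 0 \<le> ?S t" "integrable ?M (\<lambda>t. ?S t ^ p)"
      "root p (LINT t|?M. ?S t ^ p) \<le> (\<Sum>v\<in>V. root p (LINT t|?M. ?H v t ^ p))"
      using Minkowski_sum[OF p V(1), where f = ?H and M = ?M] Hm
      by (auto intro!: borel_measurable_sum sum_nonneg)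
    have dL: "(\<lambda>t. d * L t) \<in> borel_measurable ?M" "\<And>t. 0 \<le> d * L t" "integrable ?M (\<lambda>t. (d * L t) ^ p)"
      using L d by (auto simp: power_mult_distrib)
    let ?R = "\<lambda>t. d * L t + \<omega> t"
    have R: "?R \<in> borel_measurable ?M" "\<And>t. 0 \<le> ?R t" "integrable ?M (\<lambda>t. ?R t ^ p)"
      using dL(1,2) \<omega>(1,2) integrable_add_power[OF dL(1) \<omega>(1) dL(2) \<omega>(2) dL(3) \<omega>(3)] by auto
    have pointwise: "AE t in ?M. norm (h (t, x t, u (t - 1))) \<le> ?S t + ?R t"
      using Lg \<omega>f AE_space
    proof eventually_elim
      case (elim t)
      then have t: "t \<in> {a..b}" by simp
      then obtain v where v: "v \<in> V" "norm (u (t - 1) - v) < d"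
        using net C_ball_shift(2)[OF u] by fastforce
      have mem: "(x t, u (t - 1)) \<in> cball 0 r" "(x t, v) \<in> cball 0 r"
        using wu wv[OF v(1)] t by (auto simp: paths_def image_subset_iff)
      have "norm (h (t, x t, u (t - 1)) - h (t, x t, v)) \<le> ?R t"
        unfolding h_def
      proof (rule difference_bound)
        show "norm (g (t, x t, u (t - 1)) - g (t, x t, v)) \<le> L t * norm (u (t - 1) - v)"
          using elim(1) mem unfolding r_def by blast
        have "dist (x t, u (t - 1)) (x t, v) < d0"
          using v d by (simp add: dist_Pair_Pair dist_norm)
        then show "norm (f (t, x t, u (t - 1)) - f (t, x t, v)) \<le> \<omega> t"
          using elim(2) mem by blast
      qed (use v L in auto)
      \<comment> \<open>The net point v depends on t. Passing to the sum over the whole net removes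
        this dependence, so no measurable selection has to be made.\<close>
      moreover have "?H v t \<le> ?S t" using v V(1) by (intro member_le_sum) auto
      ultimately show ?case
        using norm_triangle_sub[of "h (t, x t, u (t - 1))" "h (t, x t, v)"] by linarith
    qed
    have "path_norm p {a..b} (\<lambda>t. (x t, u (t - 1))) h \<le> root p (LINT t|?M. (?S t + ?R t) ^ p)"
      unfolding path_norm_def
      by (rule root_integral_mono[OF p path_measurable[OF h wu]
            integrable_add_power[OF S(1) R(1) S(2) R(2) S(3) R(3)] pointwise])
    also have "\<dots> \<le> root p (LINT t|?M. ?S t ^ p) + root p (LINT t|?M. ?R t ^ p)"
      by (rule Minkowski_add[OF p S(1) R(1) S(2) R(2) S(3) R(3)])
    \<comment> \<open>The three quarters come from the net, from the l2-bound of g and from the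
      modulus of f.\<close>
    also have "\<dots> \<le> e / 4 + (e / 4 + e / 4)"
    proof (rule add_mono)
      have "(\<Sum>v\<in>V. root p (LINT t|?M. ?H v t ^ p)) \<le> (\<Sum>v\<in>V. d')"
        using small by (intro sum_mono) (simp add: path_norm_def h_def)
      then show "root p (LINT t|?M. ?S t ^ p) \<le> e / 4" using S(4) d'(2) by simp
      have "root p (LINT t|?M. ?R t ^ p) \<le> root p (LINT t|?M. (d * L t) ^ p) + root p (LINT t|?M. \<omega> t ^ p)"
        by (rule Minkowski_add[OF p dL(1) \<omega>(1) dL(2) \<omega>(2) dL(3) \<omega>(3)])
      also have "\<dots> \<le> e / 4 + e / 4"
      proof (rule add_mono)
        have "root p (LINT t|?M. (d * L t) ^ p) = d * root p (LINT t|?M. L t ^ p)"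
        proof -
          have "(LINT t|?M. (d * L t) ^ p) = d ^ p * (LINT t|?M. L t ^ p)"
            by (simp add: power_mult_distrib)
          then show ?thesis using d(1) p by (simp add: real_root_mult real_root_power_cancel)
        qed
        also have "\<dots> \<le> d * K"
          unfolding K_def using d p L(4) by (intro mult_left_mono) auto
        finally show "root p (LINT t|?M. (d * L t) ^ p) \<le> e / 4" using dK by linarith
      qed (use \<omega>(4) in simp)
      finally show "root p (LINT t|?M. ?R t ^ p) \<le> e / 4 + e / 4" .
    qed
    finally show "path_norm p {a..b} (\<lambda>t. (x t, u (t - 1))) (\<lambda>w. g w - f w) \<le> e"
      using e by (simp add: h_def[abs_def])
  qed
qed

section \<open>Integral means over rational subintervals\<close>

text \<open>The gauge integral is used from here on for its additivity over adjacent
  intervals.\<close>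

lemma path_mean_eq_integral:
  fixes f :: "'n::finite field"
  assumes "f \<in> SC_fun 1" "w \<in> paths {a..b} r"
  shows "path_mean {a..b} w f = norm (integral {a..b} (\<lambda>t. f (t, w t)))"
    and "(\<lambda>t. f (t, w t)) integrable_on {a..b}"
proof -
  have i: "integrable (lebesgue_on {a..b}) (\<lambda>t. f (t, w t))" by (rule path_integrable[OF assms])
  show "path_mean {a..b} w f = norm (integral {a..b} (\<lambda>t. f (t, w t)))"
    unfolding path_mean_def using lebesgue_integral_eq_integral[OF i] by simp
  show "(\<lambda>t. f (t, w t)) integrable_on {a..b}"
    using integrable_on_lebesgue_on[OF i] by simp
qed

text \<open>Moduli are non-negative, so they admit constants. These serve as delays and as the outer
  parts of a frozen path.\<close>

lemma C_moduli_const: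
  assumes "suitable_moduli \<theta>" "I \<in> rat_intervals" "norm y \<le> real j"
  shows "(\<lambda>_. y) \<in> C_moduli \<theta> I j"
proof -
  have "\<theta> I j ` {0..} \<subseteq> {0..}" using assms(1,2) unfolding suitable_moduli_def by blast
  then have "0 \<le> \<theta> I j \<bar>t - s\<bar>" for t s by (simp add: image_subset_iff)
  then show ?thesis using assms(3) unfolding C_moduli_def C_ball_def by (simp add: image_subset_iff)
qed

text \<open>Clamping t to \<open>{c..d}\<close> does not increase distances, and the modulus is
  non-decreasing.\<close>

lemma C_moduli_clamp:
  assumes \<theta>: "suitable_moduli \<theta>" and ab: "{a..b} \<in> rat_intervals" and x: "x \<in> C_moduli \<theta> {a..b} j"
    and cd: "a \<le> c" "c \<le> d" "d \<le> b"
  shows "(\<lambda>t. x (max c (min d t))) \<in> C_moduli \<theta> {a..b} j"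
proof -
  have mem: "max c (min d t) \<in> {a..b}" for t using cd by (simp add: max_def min_def)
  have "continuous_on {a..b} (\<lambda>t. x (max c (min d t)))"
  proof (rule continuous_on_compose2[where g = x and t = "{a..b}"])
    show "continuous_on {a..b} x" using x by (simp add: C_moduli_def C_ball_def)
    show "continuous_on {a..b} (\<lambda>t. max c (min d t))"
      by (intro continuous_on_max continuous_on_min continuous_on_const continuous_on_id)
    show "(\<lambda>t. max c (min d t)) ` {a..b} \<subseteq> {a..b}" using mem by blast
  qed
  moreover have "norm (x (max c (min d t)) - x (max c (min d s))) \<le> \<theta> {a..b} j \<bar>t - s\<bar>" for t s
  proof -
    have "norm (x (max c (min d t)) - x (max c (min d s)))
        \<le> \<theta> {a..b} j \<bar>max c (min d t) - max c (min d s)\<bar>"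
      using x mem[of t] mem[of s] by (simp add: C_moduli_def)
    also have "\<dots> \<le> \<theta> {a..b} j \<bar>t - s\<bar>"
    proof -
      have "mono_on {0..} (\<theta> {a..b} j)" using \<theta> ab unfolding suitable_moduli_def by blast
      moreover have "\<bar>max c (min d t) - max c (min d s)\<bar> \<le> \<bar>t - s\<bar>" by (simp add: max_def min_def)
      ultimately show ?thesis by (simp add: mono_onD)
    qed
    finally show ?thesis .
  qed
  moreover have "norm (x (max c (min d t))) \<le> real j" for t
    using x mem unfolding C_moduli_def C_ball_def by (simp add: image_subset_iff)
  ultimately show ?thesis
    unfolding C_moduli_def C_ball_def by (simp add: image_subset_iff)
qed

lemma rat_intervalsI: "a \<in> \<rat> \<Longrightarrow> b \<in> \<rat> \<Longrightarrow> a \<le> b \<Longrightarrow> {a..b} \<in> rat_intervals"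
  unfolding rat_intervals_def by blast

lemma rat_intervalsE:
  assumes "I \<in> rat_intervals"
  obtains a b where "I = {a..b}" "a \<in> \<rat>" "b \<in> \<rat>" "a \<le> b"
  using assms unfolding rat_intervals_def by blast

lemma shift_rat_intervals:
  assumes "I \<in> rat_intervals"
  shows "shift I \<in> rat_intervals"
proof -
  obtain a b where I: "I = {a..b}" "a \<in> \<rat>" "b \<in> \<rat>" "a \<le> b" using assms by (rule rat_intervalsE)
  have "shift {a..b} = {a - 1..b - 1}" by (auto intro: image_eqI[where x = "_ + 1"])
  then show ?thesis using I by (simp add: rat_intervalsI)
qed

lemma integral_sum_partition:
  fixes F :: "real \<Rightarrow> 'a::banach"
  assumes "mono c" "F integrable_on {c 0..c n}"
  shows "integral {c 0..c n} F = (\<Sum>k<n. integral {c k..c (Suc k)} F)"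
  using assms(2)
proof (induction n)
  case (Suc n)
  have c: "c 0 \<le> c n" "c n \<le> c (Suc n)" using assms(1) by (auto intro: monoD)
  have "integral {c 0..c (Suc n)} F = integral {c 0..c n} F + integral {c n..c (Suc n)} F"
    using Henstock_Kurzweil_Integration.integral_combine[OF c Suc.prems] by simp
  moreover have "F integrable_on {c 0..c n}"
    by (rule integrable_subinterval_real[OF Suc.prems]) (use c in auto)
  ultimately show ?case using Suc.IH by simp
qed simp

text \<open>
  The restriction of an element of \<open>C_moduli \<theta> {a..b} j\<close> to a subinterval \<open>{c..d}\<close> need not satisfy
  the modulus attached to \<open>{c..d}\<close>. Instead the path is frozen outside \<open>{c..d}\<close>, which keeps the
  modulus of \<open>{a..b}\<close>, and the two constant pieces are subtracted.
\<close>

lemma subinterval_mean_bound: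
  fixes h :: "'n::finite field"
  assumes h: "h \<in> SC_fun 1" and \<theta>: "suitable_moduli \<theta>"
    and rat: "a \<in> \<rat>" "b \<in> \<rat>" "c \<in> \<rat>" "d \<in> \<rat>" and ord: "a \<le> c" "c \<le> d" "d \<le> b"
    and x: "x \<in> C_moduli \<theta> {a..b} j"
    and small: "\<And>I y. I \<in> {{a..b}, {a..c}, {d..b}} \<Longrightarrow> y \<in> C_moduli \<theta> I j \<Longrightarrow>
          path_mean I (\<lambda>t. (y t, v)) h \<le> \<delta>"
  shows "norm (integral {c..d} (\<lambda>t. h (t, x t, v))) \<le> 3 * \<delta>"
proof -
  \<comment> \<open>For c = a or d = b an outer interval is a single point, which
    \<open>rat_intervals\<close> admits, so no case distinction arises.\<close>
  have I: "{a..b} \<in> rat_intervals" "{a..c} \<in> rat_intervals" "{d..b} \<in> rat_intervals"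
    using rat ord by (simp_all add: rat_intervalsI)
  define y where "y t = x (max c (min d t))" for t
  have y: "y \<in> C_moduli \<theta> {a..b} j" unfolding y_def[abs_def] by (rule C_moduli_clamp[OF \<theta> I(1) x ord])
  have nx: "norm (x t) \<le> real j" if "t \<in> {a..b}" for t
    using x that by (simp add: C_moduli_def C_ball_def image_subset_iff)
  have xc: "(\<lambda>_. x c) \<in> C_moduli \<theta> {a..c} j" "(\<lambda>_. x d) \<in> C_moduli \<theta> {d..b} j"
    by (rule C_moduli_const[OF \<theta> I(2) nx], use ord in simp)
      (rule C_moduli_const[OF \<theta> I(3) nx], use ord in simp)
  have pth: "(\<lambda>t. (z t, v)) \<in> paths {a'..b'} (real j + norm v)" if "z \<in> C_moduli \<theta> {a'..b'} j" for z a' b'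
    by (rule Pair_path[where j = j and s = "norm v"]) (use that in \<open>simp_all add: C_moduli_def\<close>)
  define F where "F t = h (t, y t, v)" for t
  have clamp: "max c (min d t) = c" if "t \<le> c" for t using that by (simp add: min.coboundedI2)
  have clamp': "max c (min d t) = d" if "d \<le> t" for t using that ord by simp
  have Fi: "F integrable_on {a..b}"
    unfolding F_def[abs_def] by (rule path_mean_eq_integral(2)[OF h pth[OF y]])
  have n1: "norm (integral {a..b} F) \<le> \<delta>"
    using small[OF _ y] path_mean_eq_integral(1)[OF h pth[OF y]] by (simp add: F_def[abs_def])
  have "integral {a..c} F = integral {a..c} (\<lambda>t. h (t, x c, v))"
    by (rule integral_cong) (simp add: F_def y_def clamp)
  then have n2: "norm (integral {a..c} F) \<le> \<delta>"
    using small[OF _ xc(1)] path_mean_eq_integral(1)[OF h pth[OF xc(1)]] by simp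
  have "integral {d..b} F = integral {d..b} (\<lambda>t. h (t, x d, v))"
    by (rule integral_cong) (use ord in \<open>simp add: F_def y_def clamp'\<close>)
  then have n3: "norm (integral {d..b} F) \<le> \<delta>"
    using small[OF _ xc(2)] path_mean_eq_integral(1)[OF h pth[OF xc(2)]] by simp
  have "integral {c..d} (\<lambda>t. h (t, x t, v)) = integral {c..d} F"
    by (rule integral_cong) (simp add: F_def y_def min.absorb2 max.absorb2)
  moreover have "integral {a..b} F = integral {a..c} F + integral {c..b} F"
    using Henstock_Kurzweil_Integration.integral_combine[OF _ _ Fi, of c] ord by simp
  moreover have "F integrable_on {c..b}"
    by (rule integrable_subinterval_real[OF Fi]) (use ord in auto)
  then have "integral {c..b} F = integral {c..d} F + integral {d..b} F"
    using Henstock_Kurzweil_Integration.integral_combine[of c d b F] ord by simp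
  \<comment> \<open>Three means of size at most \<delta> remain, one for each interval in
    \<open>small\<close>; this is the origin of the factor 3.\<close>
  ultimately have "integral {c..d} (\<lambda>t. h (t, x t, v))
      = integral {a..b} F - integral {a..c} F - integral {d..b} F" by simp
  also have "norm \<dots> \<le> norm (integral {a..b} F) + norm (integral {a..c} F) + norm (integral {d..b} F)"
    by (intro order_trans[OF norm_triangle_ineq4] add_right_mono norm_triangle_ineq4)
  finally show ?thesis using n1 n2 n3 by linarith
qed

lemma AE_lebesgue_on_subset:
  assumes "AE t in lebesgue_on {a..b::real}. P t" "{c..d} \<subseteq> {a..b}"
  shows "AE t in lebesgue_on {c..d}. P t"
proof -
  have "AE t in lebesgue. t \<in> {a..b} \<longrightarrow> P t"
    using assms(1) by (subst (asm) AE_restrict_space_iff) auto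
  then have "AE t in lebesgue_on {c..d}. t \<in> {a..b} \<longrightarrow> P t" by (rule AE_lebesgue_onI)
  then show ?thesis using AE_space by eventually_elim (use assms(2) in auto)
qed

lemma norm_integral_diff_le:
  fixes F G :: "real \<Rightarrow> 'a::euclidean_space"
  assumes "integrable (lebesgue_on {c..d}) F" "integrable (lebesgue_on {c..d}) G"
    and "integrable (lebesgue_on {c..d}) R"
    and "AE t in lebesgue_on {c..d}. norm (F t - G t) \<le> R t"
  shows "norm (integral {c..d} F) \<le> norm (integral {c..d} G) + integral {c..d} R"
proof -
  have "norm (integral {c..d} F - integral {c..d} G) = norm (LINT t|lebesgue_on {c..d}. F t - G t)"
    using assms(1,2) by (simp add: lebesgue_integral_eq_integral[symmetric])
  also have "\<dots> \<le> (LINT t|lebesgue_on {c..d}. norm (F t - G t))" by (rule integral_norm_bound)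
  also have "\<dots> \<le> (LINT t|lebesgue_on {c..d}. R t)"
    using assms by (intro integral_mono_AE) auto
  also have "\<dots> = integral {c..d} R" using assms(3) by (simp add: lebesgue_integral_eq_integral)
  finally show ?thesis
    using norm_triangle_sub[of "integral {c..d} F" "integral {c..d} G"] by linarith
qed

lemma suitable_moduli_small:
  assumes "suitable_moduli \<theta>" "I \<in> rat_intervals" "0 < e"
  obtains s where "0 < s" "\<And>y. 0 \<le> y \<Longrightarrow> y < s \<Longrightarrow> \<theta> I j y < e"
proof -
  have "continuous_on {0..} (\<theta> I j)" "\<theta> I j 0 = 0"
    using assms(1,2) unfolding suitable_moduli_def by blast+
  then obtain s where "s > 0" "\<And>y. y \<in> {0..} \<Longrightarrow> dist y 0 < s \<Longrightarrow> dist (\<theta> I j y) 0 < e"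
    using assms(3) unfolding continuous_on_iff by (metis atLeast_iff order_refl)
  then show thesis by (intro that[of s]) (auto simp: dist_real_def abs_less_iff)
qed

text \<open>The partition depends on the modulus \<open>\<theta>'\<close> but on no particular u,
  and the net only on the bounds common to E. Hence finitely many pairs of an interval and a net
  point handle all g, x and u.\<close>

lemma path_mean_control:
  fixes f :: "'n::finite field" and E :: "'n field set set"
  assumes E: "E \<subseteq> SC 1" and bd: "bounded_l2_bounds p 1 E"
    and D: "closure D = UNIV" and f: "f \<in> SC_fun 1" and e: "0 < e"
    and \<theta>: "suitable_moduli \<theta>" and \<theta>': "suitable_moduli \<theta>'"
    and rat: "a \<in> \<rat>" "b \<in> \<rat>" "a \<le> b"
  obtains V \<J> d where "finite V" "V \<subseteq> D" "finite \<J>" "\<J> \<subseteq> rat_intervals" "0 < d"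
    and "\<And>g x u. g \<in> \<Union>E \<Longrightarrow> x \<in> C_moduli \<theta> {a..b} j \<Longrightarrow> u \<in> C_moduli \<theta>' (shift {a..b}) j \<Longrightarrow>
      (\<And>v J y. v \<in> V \<Longrightarrow> J \<in> \<J> \<Longrightarrow> y \<in> C_moduli \<theta> J j \<Longrightarrow>
         path_mean J (\<lambda>t. (y t, v)) (\<lambda>w. g w - f w) \<le> d) \<Longrightarrow>
      path_mean {a..b} (\<lambda>t. (x t, u (t - 1))) (\<lambda>w. g w - f w) \<le> e"
proof -
  let ?M = "lebesgue_on {a..b}"
  define r where "r = real (2 * j + 1)"
  obtain d0 \<omega> where d0: "0 < d0" and \<omega>: "\<omega> \<in> borel_measurable ?M" "\<And>t. 0 \<le> \<omega> t"
    "integrable ?M (\<lambda>t. \<omega> t ^ 1)" "root 1 (LINT t|?M. \<omega> t ^ 1) < e / 4"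
    and \<omega>f: "AE t in ?M. \<forall>z\<in>cball 0 r. \<forall>z'\<in>cball 0 r. dist z z' < d0 \<longrightarrow>
           norm (f (t, z) - f (t, z')) \<le> \<omega> t"
    by (rule SC_fun_modulus[OF order_refl f, where e = "e / 4" and a = a and b = b and r = r])
      (use e in auto)
  obtain C where C: "0 \<le> C" and CL: "\<And>g. g \<in> \<Union>E \<Longrightarrow> \<exists>L. L \<in> borel_measurable ?M \<and> (\<forall>t. 0 \<le> L t) \<and>
        integrable ?M (\<lambda>t. L t ^ 1) \<and> (LINT t|?M. L t ^ 1) \<le> C \<and>
        (AE t in ?M. \<forall>x u v. (x, u) \<in> cball 0 (real (2 * j + 1)) \<longrightarrow> (x, v) \<in> cball 0 (real (2 * j + 1)) \<longrightarrow>
           norm (g (t, x, u) - g (t, x, v)) \<le> L t * norm (u - v))"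
    by (rule bounded_l2_boundsD[OF bd, where a = a and b = b and j = "2 * j + 1"]) blast
  define d where "d = min d0 (min 1 (e / (4 * (C + 1))))"
  have d: "0 < d" "d \<le> d0" "d \<le> 1" using d0 e C by (auto simp: d_def)
  have dC: "d * C \<le> e / 4"
  proof -
    have "d * C \<le> e / (4 * (C + 1)) * (C + 1)"
      using C d by (intro mult_mono) (auto simp: d_def)
    also have "\<dots> = e / 4" using C by (simp add: field_simps)
    finally show ?thesis .
  qed
  \<comment> \<open>The distance d is shared equally: d / 2 for the mesh of the net and d / 2 for
    the variation of u over one piece of the partition.\<close>
  obtain V where V: "finite V" "V \<subseteq> D" "\<And>v. v \<in> V \<Longrightarrow> norm v \<le> real j + d / 2"
    and net: "\<And>u. u \<in> cball 0 (real j) \<Longrightarrow> \<exists>v\<in>V. norm (u - v) < d / 2"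
    by (rule finite_net_from_dense[OF D, where d = "d / 2" and r = "real j"]) (use d in auto)
  have "shift {a..b} \<in> rat_intervals" using rat by (intro shift_rat_intervals rat_intervalsI)
  then obtain s where s: "0 < s" "\<And>y. 0 \<le> y \<Longrightarrow> y < s \<Longrightarrow> \<theta>' (shift {a..b}) j y < d / 2"
    by (rule suitable_moduli_small[OF \<theta>', where e = "d / 2" and j = j]) (use d in auto)
  obtain n0 where n0: "(b - a) / s < real n0" using reals_Archimedean2 by blast
  define n where "n = Suc n0"
  have n: "0 < n" "(b - a) / real n < s"
  proof -
    have "(b - a) / s < real n" using n0 by (simp add: n_def)
    then show "(b - a) / real n < s" using s(1) by (simp add: n_def field_simps)
  qed (simp add: n_def)
  \<comment> \<open>Equal division of an interval with rational endpoints has rational nodes, so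
    seminorms are available on the intervals ending at them.\<close>
  define c where "c k = a + real k * ((b - a) / real n)" for k
  have c0: "c 0 = a" "c n = b" using n by (simp_all add: c_def)
  have step: "c (Suc k) - c k = (b - a) / real n" for k by (simp add: c_def distrib_right add_divide_distrib)
  have cmono: "mono c" using rat(3) unfolding c_def mono_def by (auto intro!: divide_right_mono mult_right_mono)
  have cab: "a \<le> c k" "c k \<le> c (Suc k)" "c (Suc k) \<le> b" if "k < n" for k
    using monoD[OF cmono, of 0 k] monoD[OF cmono, of k "Suc k"] monoD[OF cmono, of "Suc k" n] that
    unfolding c0 by simp_all
  have crat: "c k \<in> \<rat>" for k using rat by (simp add: c_def)
  \<comment> \<open>The intervals required by \<open>subinterval_mean_bound\<close>: the whole
    interval and, for each piece, what lies to its left and to its right.\<close>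
  define \<J> where "\<J> = insert {a..b} ((\<lambda>k. {a..c k}) ` {..<n} \<union> (\<lambda>k. {c (Suc k)..b}) ` {..<n})"
  \<comment> \<open>Each of the n pieces costs 3 * \<delta>, so 12 = 3 * 4 makes the total e /
    4.\<close>
  define \<delta> where "\<delta> = e / (12 * real n)"
  have \<delta>: "0 < \<delta>" "real n * (3 * \<delta>) = e / 4" using n e by (simp_all add: \<delta>_def)
  show thesis
  proof (rule that[OF V(1,2) _ _ \<delta>(1)])
    show "finite \<J>" by (simp add: \<J>_def)
    show "\<J> \<subseteq> rat_intervals"
      unfolding \<J>_def using rat crat cab by (auto intro!: rat_intervalsI)
    fix g :: "'n field" and x u :: "real \<Rightarrow> real ^ 'n"
    assume g: "g \<in> \<Union>E" and x: "x \<in> C_moduli \<theta> {a..b} j" and u: "u \<in> C_moduli \<theta>' (shift {a..b}) j"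
      and small: "\<And>v J y. v \<in> V \<Longrightarrow> J \<in> \<J> \<Longrightarrow> y \<in> C_moduli \<theta> J j \<Longrightarrow>
         path_mean J (\<lambda>t. (y t, v)) (\<lambda>w. g w - f w) \<le> \<delta>"
    define h where "h w = g w - f w" for w
    have "g \<in> SC_fun 1" using g E SC_class(2)[of 1] by blast
    then have h: "h \<in> SC_fun 1" unfolding h_def[abs_def] using f by (intro SC_fun_diff)
    have xb: "x \<in> C_ball {a..b} j" and ub: "u \<in> C_ball (shift {a..b}) j"
      using x u by (simp_all add: C_moduli_def)
    have wu: "(\<lambda>t. (x t, u (t - 1))) \<in> paths {a..b} r"
      by (rule Pair_path[OF xb C_ball_shift[OF ub]]) (auto simp: r_def)
    have wv: "(\<lambda>t. (x t, v)) \<in> paths {a..b} r" if "v \<in> V" for v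
      by (rule Pair_path[OF xb, where s = "real j + d / 2"]) (use V(3)[OF that] d in \<open>auto simp: r_def\<close>)
    obtain L where L: "L \<in> borel_measurable ?M" "\<And>t. 0 \<le> L t"
        "integrable ?M (\<lambda>t. L t ^ 1)" "(LINT t|?M. L t ^ 1) \<le> C"
      and Lg: "AE t in ?M. \<forall>x u v. (x, u) \<in> cball 0 (real (2 * j + 1)) \<longrightarrow> (x, v) \<in> cball 0 (real (2 * j + 1)) \<longrightarrow>
           norm (g (t, x, u) - g (t, x, v)) \<le> L t * norm (u - v)"
      using CL[OF g] by blast
    define F where "F t = h (t, x t, u (t - 1))" for t
    define R where "R t = d * L t + \<omega> t" for t
    have Fi: "integrable ?M F" unfolding F_def[abs_def] by (rule path_integrable[OF h wu])
    have Ri: "integrable ?M R" unfolding R_def[abs_def] using L(3) \<omega>(3) by simp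
    have piece: "norm (integral {c k..c (Suc k)} F) \<le> 3 * \<delta> + integral {c k..c (Suc k)} R" if k: "k < n" for k
    proof -
      let ?J = "{c k..c (Suc k)}"
      have sub: "?J \<subseteq> {a..b}" using cab[OF k] by auto
      \<comment> \<open>The net point is chosen at the left end of the piece; the modulus of u then
        keeps it within d of u on the whole piece.\<close>
      have uk: "norm (u (c k - 1)) \<le> real j"
        using C_ball_shift(2)[OF ub, of "c k"] sub cab[OF k] by auto
      then obtain v where v: "v \<in> V" "norm (u (c k - 1) - v) < d / 2"
        using net[of "u (c k - 1)"] by auto
      have near: "norm (u (t - 1) - v) < d" if t: "t \<in> ?J" for t
      proof -
        have "t - 1 \<in> shift {a..b}" "c k - 1 \<in> shift {a..b}" using t sub cab[OF k] by auto
        then have "norm (u (t - 1) - u (c k - 1)) \<le> \<theta>' (shift {a..b}) j \<bar>(t - 1) - (c k - 1)\<bar>"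
          using u unfolding C_moduli_def by blast
        also have "\<dots> < d / 2"
        proof (rule s(2))
          have "\<bar>(t - 1) - (c k - 1)\<bar> \<le> (b - a) / real n" using t step[of k] by auto
          then show "\<bar>(t - 1) - (c k - 1)\<bar> < s" using n(2) by linarith
        qed simp
        finally show ?thesis
          using v(2) norm_triangle_ineq[of "u (t - 1) - u (c k - 1)" "u (c k - 1) - v"] by simp
      qed
      have "norm (integral ?J F) \<le> norm (integral ?J (\<lambda>t. h (t, x t, v))) + integral ?J R"
      proof (rule norm_integral_diff_le)
        show "integrable (lebesgue_on ?J) F" "integrable (lebesgue_on ?J) R"
          "integrable (lebesgue_on ?J) (\<lambda>t. h (t, x t, v))"
          by (rule Equivalence_Lebesgue_Henstock_Integration.integrable_subinterval[OF _ sub], rule Fi Ri path_integrable[OF h wv[OF v(1)]])+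
        show "AE t in lebesgue_on ?J. norm (F t - h (t, x t, v)) \<le> R t"
          using AE_lebesgue_on_subset[OF Lg sub] AE_lebesgue_on_subset[OF \<omega>f sub] AE_space
        proof eventually_elim
          case (elim t)
          then have t: "t \<in> ?J" "t \<in> {a..b}" using sub by auto
          have mem: "(x t, u (t - 1)) \<in> cball 0 r" "(x t, v) \<in> cball 0 r"
            using wu wv[OF v(1)] t(2) by (auto simp: paths_def image_subset_iff)
          show ?case
            unfolding F_def h_def R_def
          proof (rule difference_bound)
            show "norm (g (t, x t, u (t - 1)) - g (t, x t, v)) \<le> L t * norm (u (t - 1) - v)"
              using elim(1) mem unfolding r_def by blast
            have "dist (x t, u (t - 1)) (x t, v) < d0"
              using near[OF t(1)] d by (simp add: dist_Pair_Pair dist_norm)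
            then show "norm (f (t, x t, u (t - 1)) - f (t, x t, v)) \<le> \<omega> t"
              using elim(2) mem by blast
          qed (use near[OF t(1)] L in auto)
        qed
      qed
      moreover have "norm (integral ?J (\<lambda>t. h (t, x t, v))) \<le> 3 * \<delta>"
      proof (rule subinterval_mean_bound[OF h \<theta> rat(1,2) crat crat cab[OF k] x])
        fix I :: "real set" and y :: "real \<Rightarrow> real ^ 'n"
        assume "I \<in> {{a..b}, {a..c k}, {c (Suc k)..b}}" "y \<in> C_moduli \<theta> I j"
        moreover have "{{a..b}, {a..c k}, {c (Suc k)..b}} \<subseteq> \<J>" using k by (auto simp: \<J>_def)
        ultimately show "path_mean I (\<lambda>t. (y t, v)) h \<le> \<delta>"
          using small[OF v(1)] unfolding h_def[abs_def] by blast
      qed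
      ultimately show ?thesis by linarith
    qed
    have Fs: "integral {a..b} F = (\<Sum>k<n. integral {c k..c (Suc k)} F)"
      using integral_sum_partition[OF cmono, of F n] integrable_on_lebesgue_on[OF Fi]
      by (simp add: c0)
    have Rs: "integral {a..b} R = (\<Sum>k<n. integral {c k..c (Suc k)} R)"
      using integral_sum_partition[OF cmono, of R n] integrable_on_lebesgue_on[OF Ri]
      by (simp add: c0)
    have "integral {a..b} R = (LINT t|?M. R t)" using Ri by (simp add: lebesgue_integral_eq_integral)
    also have "\<dots> = d * (LINT t|?M. L t) + (LINT t|?M. \<omega> t)"
      unfolding R_def using L(3) \<omega>(3) by simp
    also have "\<dots> \<le> e / 4 + e / 4"
    proof (rule add_mono)
      have "d * (LINT t|?M. L t) \<le> d * C" using L(4) d by (intro mult_left_mono) simp_all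
      then show "d * (LINT t|?M. L t) \<le> e / 4" using dC by linarith
    qed (use \<omega>(4) in simp)
    finally have R: "integral {a..b} R \<le> e / 4 + e / 4" .
    have "path_mean {a..b} (\<lambda>t. (x t, u (t - 1))) h = norm (integral {a..b} F)"
      using path_mean_eq_integral(1)[OF h wu] by (simp add: F_def[abs_def])
    also have "\<dots> \<le> (\<Sum>k<n. norm (integral {c k..c (Suc k)} F))"
      unfolding Fs by (rule norm_sum)
    also have "\<dots> \<le> (\<Sum>k<n. 3 * \<delta> + integral {c k..c (Suc k)} R)"
      by (intro sum_mono piece) simp
    also have "\<dots> = real n * (3 * \<delta>) + integral {a..b} R"
      unfolding Rs by (simp add: sum.distrib)
    \<comment> \<open>The pieces contribute e / 4; the l2-bound of g and the modulus of f together
      contribute at most e / 2.\<close>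
    also have "\<dots> \<le> e" using R \<delta>(2) e by linarith
    finally show "path_mean {a..b} (\<lambda>t. (x t, u (t - 1))) (\<lambda>w. g w - f w) \<le> e"
      by (simp add: h_def[abs_def])
  qed
qed

subsection \<open>The five topologies\<close>

text \<open>
  The facts shared by the \<open>L\<^sup>p\<close> seminorms and the weak seminorms along a path, so that the
  comparisons that do not use the \<open>l\<^sub>2\<close>-bounds are proved once.
\<close>

definition path_functional ::
    "nat \<Rightarrow> (real set \<Rightarrow> (real \<Rightarrow> (real ^ 'n) \<times> (real ^ 'n)) \<Rightarrow> ('n::finite) field \<Rightarrow> real) \<Rightarrow> bool" where
  "path_functional p N \<longleftrightarrow>
     (\<forall>a b r. \<forall>w\<in>paths {a..b} r. adapted p (N {a..b} w)) \<and>
     (\<forall>a b r. \<forall>f\<in>SC_fun p. \<forall>W\<subseteq>paths {a..b} r. bdd_above ((\<lambda>w. N {a..b} w f) ` W))"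

lemma path_functionalD:
  assumes "path_functional p N"
  shows "\<And>a b r w. w \<in> paths {a..b} r \<Longrightarrow> adapted p (N {a..b} w)"
    and "\<And>a b r f W. f \<in> SC_fun p \<Longrightarrow> W \<subseteq> paths {a..b} r \<Longrightarrow> bdd_above ((\<lambda>w. N {a..b} w f) ` W)"
  subgoal for a b r w by (rule assms[unfolded path_functional_def, THEN conjunct1, rule_format])
  subgoal for a b r f W by (rule assms[unfolded path_functional_def, THEN conjunct2, rule_format])
  done

lemma path_functional_path_norm: "1 \<le> p \<Longrightarrow> path_functional p (path_norm p)"
  unfolding path_functional_def
  by (intro conjI allI ballI impI adapted_path_norm bdd_above_path_norm) auto

lemma path_functional_path_mean: "path_functional 1 path_mean"
  unfolding path_functional_def
  by (intro conjI allI ballI impI adapted_path_mean bdd_above_path_mean) auto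

definition sup_const ::
    "(real set \<Rightarrow> (real \<Rightarrow> (real ^ 'n) \<times> (real ^ 'n)) \<Rightarrow> ('n::finite) field \<Rightarrow> real) \<Rightarrow>
     moduli \<Rightarrow> real set \<Rightarrow> nat \<Rightarrow> real ^ 'n \<Rightarrow> 'n field \<Rightarrow> real" where
  "sup_const N \<theta> I j v f = (SUP x\<in>C_moduli \<theta> I j. N I (\<lambda>t. (x t, v)) f)"

text \<open>\<open>U\<close> is the class of delays, so that \<open>C_moduli \<theta>'\<close> and
  \<open>C_ball\<close> are treated alike. Indexing by pairs makes the double supremum an instance
  of \<open>adapted_SUP\<close>.\<close>

definition sup_delay ::
    "(real set \<Rightarrow> (real \<Rightarrow> (real ^ 'n) \<times> (real ^ 'n)) \<Rightarrow> ('n::finite) field \<Rightarrow> real) \<Rightarrow>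
     moduli \<Rightarrow> (real set \<Rightarrow> nat \<Rightarrow> (real \<Rightarrow> real ^ 'n) set) \<Rightarrow> real set \<Rightarrow> nat \<Rightarrow> 'n field \<Rightarrow> real" where
  "sup_delay N \<theta> U I j f =
     (SUP i\<in>C_moduli \<theta> I j \<times> U (shift I) j. N I (\<lambda>t. (fst i t, snd i (t - 1))) f)"

lemma seminorms_alt:
  "T_D_seminorms p \<theta> D = {sup_const (path_norm p) \<theta> I j u | I j u. I \<in> rat_intervals \<and> u \<in> D}"
  "T_moduli_seminorms p \<theta> \<theta>' = {sup_delay (path_norm p) \<theta> (C_moduli \<theta>') I j | I j. I \<in> rat_intervals}"
  "T_B_seminorms p \<theta> = {sup_delay (path_norm p) \<theta> C_ball I j | I j. I \<in> rat_intervals}"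
  "sigma_D_seminorms \<theta> D = {sup_const path_mean \<theta> I j u | I j u. I \<in> rat_intervals \<and> u \<in> D}"
  "sigma_moduli_seminorms \<theta> \<theta>' = {sup_delay path_mean \<theta> (C_moduli \<theta>') I j | I j. I \<in> rat_intervals}"
  unfolding T_D_seminorms_def T_moduli_seminorms_def T_B_seminorms_def sigma_D_seminorms_def
    sigma_moduli_seminorms_def sup_const_def[abs_def] sup_delay_def[abs_def]
    path_norm_def path_mean_def case_prod_beta'
  by (rule refl)+

lemma C_moduli_mono:
  assumes "suitable_moduli \<theta>" "I \<in> rat_intervals" "j \<le> k"
  shows "C_moduli \<theta> I j \<subseteq> C_moduli \<theta> I k"
proof
  fix x :: "real \<Rightarrow> real ^ 'b" assume x: "x \<in> C_moduli \<theta> I j"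
  have le: "\<theta> I j s \<le> \<theta> I k s" if "0 \<le> s" for s
    using assms that unfolding suitable_moduli_def by blast
  have "norm (x t) \<le> real k" if "t \<in> I" for t
    using x that assms(3) by (force simp: C_moduli_def C_ball_def image_subset_iff)
  moreover have "norm (x t - x s) \<le> \<theta> I k \<bar>t - s\<bar>" if "t \<in> I" "s \<in> I" for t s
    using x that le[of "\<bar>t - s\<bar>"] unfolding C_moduli_def by force
  ultimately show "x \<in> C_moduli \<theta> I k"
    using x by (simp add: C_moduli_def C_ball_def image_subset_iff)
qed

lemma C_moduli_nonempty:
  assumes "suitable_moduli \<theta>" "I \<in> rat_intervals"
  shows "C_moduli \<theta> I j \<noteq> {}"
  using C_moduli_const[OF assms, of 0 j] by auto

lemma C_moduli_delays:
  assumes "suitable_moduli \<theta>" "I \<in> rat_intervals"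
  shows "C_moduli \<theta> (shift I) j \<subseteq> C_ball (shift I) j" "C_moduli \<theta> (shift I) j \<noteq> {}"
  using C_moduli_nonempty[OF assms(1) shift_rat_intervals[OF assms(2)]] by (auto simp: C_moduli_def)

lemma const_path:
  "x \<in> C_moduli \<theta> {a..b} j \<Longrightarrow> (\<lambda>t. (x t, v)) \<in> paths {a..b} (real j + norm v)"
  by (rule Pair_path[where j = j and s = "norm v"]) (simp_all add: C_moduli_def)

lemma delay_path:
  "x \<in> C_moduli \<theta> {a..b} j \<Longrightarrow> u \<in> C_ball (shift {a..b}) j \<Longrightarrow>
    (\<lambda>t. (x t, u (t - 1))) \<in> paths {a..b} (real j + real j)"
  by (rule Pair_path[where j = j and s = "real j"]) (simp_all add: C_moduli_def C_ball_shift)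

lemma
  fixes N :: "real set \<Rightarrow> (real \<Rightarrow> (real ^ 'n) \<times> (real ^ 'n)) \<Rightarrow> ('n::finite) field \<Rightarrow> real"
  assumes N: "path_functional p N" and \<theta>: "suitable_moduli \<theta>" and I: "I \<in> rat_intervals"
  shows adapted_sup_const: "adapted p (sup_const N \<theta> I j v)"
    and sup_const_upper: "f \<in> SC_fun p \<Longrightarrow> x \<in> C_moduli \<theta> I j \<Longrightarrow>
      N I (\<lambda>t. (x t, v)) f \<le> sup_const N \<theta> I j v f"
proof -
  obtain a b where ab: "I = {a..b}" using I by (rule rat_intervalsE)
  have bdd: "bdd_above ((\<lambda>x. N I (\<lambda>t. (x t, v)) f) ` C_moduli \<theta> I j)" if "f \<in> SC_fun p" for f
  proof -
    have "(\<lambda>x t. (x t, v)) ` C_moduli \<theta> I j \<subseteq> paths {a..b} (real j + norm v)"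
      unfolding ab using const_path by blast
    from path_functionalD(2)[OF N that this] show ?thesis by (simp add: ab image_image)
  qed
  show "adapted p (sup_const N \<theta> I j v)"
    unfolding sup_const_def[abs_def]
  proof (rule adapted_SUP[OF C_moduli_nonempty[OF \<theta> I] _ bdd])
    show "adapted p (N I (\<lambda>t. (x t, v)))" if "x \<in> C_moduli \<theta> I j" for x
      using path_functionalD(1)[OF N const_path] that unfolding ab by blast
  qed
  show "N I (\<lambda>t. (x t, v)) f \<le> sup_const N \<theta> I j v f" if "f \<in> SC_fun p" "x \<in> C_moduli \<theta> I j"
    unfolding sup_const_def by (rule cSUP_upper[OF that(2) bdd[OF that(1)]])
qed

lemma
  fixes N :: "real set \<Rightarrow> (real \<Rightarrow> (real ^ 'n) \<times> (real ^ 'n)) \<Rightarrow> ('n::finite) field \<Rightarrow> real"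
  assumes N: "path_functional p N" and \<theta>: "suitable_moduli \<theta>" and I: "I \<in> rat_intervals"
    and U: "U (shift I) j \<subseteq> C_ball (shift I) j" "U (shift I) j \<noteq> {}"
  shows adapted_sup_delay: "adapted p (sup_delay N \<theta> U I j)"
    and sup_delay_upper: "f \<in> SC_fun p \<Longrightarrow> x \<in> C_moduli \<theta> I j \<Longrightarrow> u \<in> U (shift I) j \<Longrightarrow>
      N I (\<lambda>t. (x t, u (t - 1))) f \<le> sup_delay N \<theta> U I j f"
proof -
  let ?S = "C_moduli \<theta> I j \<times> U (shift I) j"
  obtain a b where ab: "I = {a..b}" using I by (rule rat_intervalsE)
  have pth: "(\<lambda>t. (fst i t, snd i (t - 1))) \<in> paths {a..b} (real j + real j)" if "i \<in> ?S" for i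
    using that U(1) unfolding ab by (intro delay_path[where \<theta> = \<theta>]) auto
  have bdd: "bdd_above ((\<lambda>i. N I (\<lambda>t. (fst i t, snd i (t - 1))) f) ` ?S)" if "f \<in> SC_fun p" for f
  proof -
    have "(\<lambda>i t. (fst i t, snd i (t - 1))) ` ?S \<subseteq> paths {a..b} (real j + real j)"
      using pth by blast
    from path_functionalD(2)[OF N that this] show ?thesis by (simp add: ab image_image)
  qed
  have "?S \<noteq> {}" using C_moduli_nonempty[OF \<theta> I, of j] U(2) by auto
  then show "adapted p (sup_delay N \<theta> U I j)"
    unfolding sup_delay_def[abs_def]
  proof (rule adapted_SUP[OF _ _ bdd])
    show "adapted p (N I (\<lambda>t. (fst i t, snd i (t - 1))))" if "i \<in> ?S" for i
      using path_functionalD(1)[OF N pth[OF that]] by (simp add: ab)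
  qed
  show "N I (\<lambda>t. (x t, u (t - 1))) f \<le> sup_delay N \<theta> U I j f"
    if "f \<in> SC_fun p" "x \<in> C_moduli \<theta> I j" "u \<in> U (shift I) j"
    using cSUP_upper[OF _ bdd[OF that(1)], of "(x, u)"] that(2,3) unfolding sup_delay_def by simp
qed

text \<open>A point v of D may lie outside the ball of radius j; as a constant delay it is then
  admissible only for a larger index k. \<open>C_moduli_mono\<close> lets x follow to that
  index.\<close>

lemma sup_const_le_sup_delay:
  fixes N :: "real set \<Rightarrow> (real \<Rightarrow> (real ^ 'n) \<times> (real ^ 'n)) \<Rightarrow> ('n::finite) field \<Rightarrow> real"
  assumes N: "path_functional p N" and \<theta>: "suitable_moduli \<theta>" and \<theta>': "suitable_moduli \<theta>'"
    and I: "I \<in> rat_intervals" and f: "f \<in> SC_fun p"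
    and k: "j \<le> k" "norm v \<le> real k"
  shows "sup_const N \<theta> I j v f \<le> sup_delay N \<theta> (C_moduli \<theta>') I k f"
  unfolding sup_const_def
proof (rule cSUP_least[OF C_moduli_nonempty[OF \<theta> I]])
  note J = shift_rat_intervals[OF I]
  fix x :: "real \<Rightarrow> real ^ 'n" assume "x \<in> C_moduli \<theta> I j"
  then have x: "x \<in> C_moduli \<theta> I k" using C_moduli_mono[OF \<theta> I k(1)] by blast
  from sup_delay_upper[where U = "C_moduli \<theta>'", OF N \<theta> I C_moduli_delays[OF \<theta>' I] f x C_moduli_const[OF \<theta>' J k(2)]]
  show "N I (\<lambda>t. (x t, v)) f \<le> sup_delay N \<theta> (C_moduli \<theta>') I k f" by simp
qed

lemma weaker_on_sup_const_sup_delay: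
  fixes N :: "real set \<Rightarrow> (real \<Rightarrow> (real ^ 'n) \<times> (real ^ 'n)) \<Rightarrow> ('n::finite) field \<Rightarrow> real"
  assumes p: "1 \<le> p" and E: "E \<subseteq> SC p" and N: "path_functional p N"
    and \<theta>: "suitable_moduli \<theta>" and \<theta>': "suitable_moduli \<theta>'"
  shows "weaker_on E (seminorm_topology (SC p) {sup_const N \<theta> I j u | I j u. I \<in> rat_intervals \<and> u \<in> D})
           (seminorm_topology (SC p) {sup_delay N \<theta> (C_moduli \<theta>') I j | I j. I \<in> rat_intervals})"
proof (rule weaker_on_seminorm_topology[OF p E])
  show "adapted p \<rho>" if "\<rho> \<in> {sup_const N \<theta> I j u | I j u. I \<in> rat_intervals \<and> u \<in> D}" for \<rho>
    using that adapted_sup_const[OF N \<theta>] by blast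
  show "adapted p \<rho>" if \<rho>Q: "\<rho> \<in> {sup_delay N \<theta> (C_moduli \<theta>') I j | I j. I \<in> rat_intervals}" for \<rho>
  proof -
    obtain I j where \<rho>: "\<rho> = sup_delay N \<theta> (C_moduli \<theta>') I j" and I: "I \<in> rat_intervals"
      using \<rho>Q by blast
    show ?thesis
      unfolding \<rho> by (rule adapted_sup_delay[where U = "C_moduli \<theta>'", OF N \<theta> I C_moduli_delays[OF \<theta>' I]])
  qed
  have "{0..0} \<in> rat_intervals" by (rule rat_intervalsI) auto
  then show "{sup_delay N \<theta> (C_moduli \<theta>') I j | I j. I \<in> rat_intervals} \<noteq> {}" by blast
  fix f :: "'n field" and \<rho> :: "'n field \<Rightarrow> real" and e :: real
  assume f: "f \<in> SC_fun p" and "\<rho> \<in> {sup_const N \<theta> I j u | I j u. I \<in> rat_intervals \<and> u \<in> D}"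
    and e: "0 < e"
  then obtain I j v where \<rho>: "\<rho> = sup_const N \<theta> I j v" and I: "I \<in> rat_intervals" by blast
  obtain m where m: "norm v \<le> real m" using real_arch_simple by blast
  define k where "k = max j m"
  have k: "j \<le> k" "norm v \<le> real k" using m by (auto simp: k_def)
  show "\<exists>R d. finite R \<and> R \<subseteq> {sup_delay N \<theta> (C_moduli \<theta>') I j | I j. I \<in> rat_intervals} \<and> d > 0 \<and>
      (\<forall>g\<in>\<Union>E. (\<forall>\<rho>'\<in>R. \<rho>' (\<lambda>w. g w - f w) < d) \<longrightarrow> \<rho> (\<lambda>w. g w - f w) < e)"
  proof (intro exI conjI ballI impI)
    show "{sup_delay N \<theta> (C_moduli \<theta>') I k} \<subseteq> {sup_delay N \<theta> (C_moduli \<theta>') I j | I j. I \<in> rat_intervals}"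
      using I by blast
    fix g assume "g \<in> \<Union>E" and small: "\<forall>\<rho>'\<in>{sup_delay N \<theta> (C_moduli \<theta>') I k}. \<rho>' (\<lambda>w. g w - f w) < e"
    then have "g \<in> SC_fun p" using E SC_class(2)[OF p] by blast
    then have h: "(\<lambda>w. g w - f w) \<in> SC_fun p" using f by (intro SC_fun_diff)
    have "\<rho> (\<lambda>w. g w - f w) \<le> sup_delay N \<theta> (C_moduli \<theta>') I k (\<lambda>w. g w - f w)"
      unfolding \<rho> by (rule sup_const_le_sup_delay[OF N \<theta> \<theta>' I h k])
    also have "\<dots> < e" using small by blast
    finally show "\<rho> (\<lambda>w. g w - f w) < e" .
  qed (use e in simp_all)
qed

section \<open>The five families of seminorms are adapted and nonempty\<close>

lemma adapted_T_D:
  "1 \<le> p \<Longrightarrow> suitable_moduli \<theta> \<Longrightarrow> \<rho> \<in> T_D_seminorms p \<theta> D \<Longrightarrow> adapted p \<rho>"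
  unfolding seminorms_alt using adapted_sup_const[OF path_functional_path_norm] by blast

lemma adapted_sigma_D:
  "suitable_moduli \<theta> \<Longrightarrow> \<rho> \<in> sigma_D_seminorms \<theta> D \<Longrightarrow> adapted 1 \<rho>"
  unfolding seminorms_alt using adapted_sup_const[OF path_functional_path_mean] by blast

lemma adapted_T_moduli:
  assumes "1 \<le> p" "suitable_moduli \<theta>" "suitable_moduli \<theta>'" and \<rho>: "\<rho> \<in> T_moduli_seminorms p \<theta> \<theta>'"
  shows "adapted p \<rho>"
proof -
  obtain I j where "\<rho> = sup_delay (path_norm p) \<theta> (C_moduli \<theta>') I j" and I: "I \<in> rat_intervals"
    using \<rho> unfolding seminorms_alt by blast
  then show ?thesis
    using adapted_sup_delay[where U = "C_moduli \<theta>'",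
        OF path_functional_path_norm[OF assms(1)] assms(2) I C_moduli_delays[OF assms(3) I]] by simp
qed

lemma adapted_sigma_moduli:
  assumes "suitable_moduli \<theta>" "suitable_moduli \<theta>'" and \<rho>: "\<rho> \<in> sigma_moduli_seminorms \<theta> \<theta>'"
  shows "adapted 1 \<rho>"
proof -
  obtain I j where "\<rho> = sup_delay path_mean \<theta> (C_moduli \<theta>') I j" and I: "I \<in> rat_intervals"
    using \<rho> unfolding seminorms_alt by blast
  then show ?thesis
    using adapted_sup_delay[where U = "C_moduli \<theta>'",
        OF path_functional_path_mean assms(1) I C_moduli_delays[OF assms(2) I]] by simp
qed

lemma C_ball_nonempty: "C_ball I j \<noteq> {}"
proof -
  have "(\<lambda>_. 0) \<in> C_ball I j" by (auto simp: C_ball_def)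
  then show ?thesis by blast
qed

lemma adapted_T_B:
  assumes "1 \<le> p" "suitable_moduli \<theta>" and \<rho>: "\<rho> \<in> T_B_seminorms p \<theta>"
  shows "adapted p \<rho>"
proof -
  obtain I j where "\<rho> = sup_delay (path_norm p) \<theta> C_ball I j" and I: "I \<in> rat_intervals"
    using \<rho> unfolding seminorms_alt by blast
  then show ?thesis
    using adapted_sup_delay[where U = C_ball,
        OF path_functional_path_norm[OF assms(1)] assms(2) I order_refl C_ball_nonempty] by simp
qed

lemma seminorms_nonempty:
  fixes D :: "(real ^ 'n::finite) set"
  shows "D \<noteq> {} \<Longrightarrow> T_D_seminorms p \<theta> D \<noteq> {}"
    and "T_moduli_seminorms p \<theta> \<theta>' \<noteq> ({} :: ('n field \<Rightarrow> real) set)"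
    and "T_B_seminorms p \<theta> \<noteq> ({} :: ('n field \<Rightarrow> real) set)"
    and "D \<noteq> {} \<Longrightarrow> sigma_D_seminorms \<theta> D \<noteq> {}"
    and "sigma_moduli_seminorms \<theta> \<theta>' \<noteq> ({} :: ('n field \<Rightarrow> real) set)"
proof -
  have I: "{0..0} \<in> rat_intervals" by (rule rat_intervalsI) auto
  show "D \<noteq> {} \<Longrightarrow> T_D_seminorms p \<theta> D \<noteq> {}" "T_moduli_seminorms p \<theta> \<theta>' \<noteq> ({} :: ('n field \<Rightarrow> real) set)"
    "T_B_seminorms p \<theta> \<noteq> ({} :: ('n field \<Rightarrow> real) set)" "D \<noteq> {} \<Longrightarrow> sigma_D_seminorms \<theta> D \<noteq> {}"
    "sigma_moduli_seminorms \<theta> \<theta>' \<noteq> ({} :: ('n field \<Rightarrow> real) set)"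
    unfolding seminorms_alt using I by blast+
qed

section \<open>Pairwise comparison of the topologies\<close>

lemma T_D_weaker_T_moduli:
  fixes E :: "('n::finite) field set set"
  assumes "1 \<le> p" "E \<subseteq> SC p" "suitable_moduli \<theta>" "suitable_moduli \<theta>'"
  shows "weaker_on E (T_D p \<theta> D) (T_moduli p \<theta> \<theta>')"
  unfolding T_D_def T_moduli_def seminorms_alt
  by (rule weaker_on_sup_const_sup_delay[OF assms(1,2) path_functional_path_norm[OF assms(1)] assms(3,4)])

lemma sigma_D_weaker_sigma_moduli:
  fixes E :: "('n::finite) field set set"
  assumes "E \<subseteq> SC 1" "suitable_moduli \<theta>" "suitable_moduli \<theta>'"
  shows "weaker_on E (sigma_D \<theta> D) (sigma_moduli \<theta> \<theta>')"
  unfolding sigma_D_def sigma_moduli_def seminorms_alt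
  by (rule weaker_on_sup_const_sup_delay[OF order_refl assms(1) path_functional_path_mean assms(2,3)])

lemma T_moduli_weaker_T_B:
  fixes E :: "('n::finite) field set set"
  assumes p: "1 \<le> p" and E: "E \<subseteq> SC p" and \<theta>: "suitable_moduli \<theta>" and \<theta>': "suitable_moduli \<theta>'"
  shows "weaker_on E (T_moduli p \<theta> \<theta>') (T_B p \<theta>)"
  unfolding T_moduli_def T_B_def
proof (rule weaker_on_seminorm_topology[OF p E])
  fix f :: "'n field" and \<rho> :: "'n field \<Rightarrow> real" and e :: real
  assume f: "f \<in> SC_fun p" and "\<rho> \<in> T_moduli_seminorms p \<theta> \<theta>'" and e: "0 < e"
  then obtain I j where \<rho>: "\<rho> = sup_delay (path_norm p) \<theta> (C_moduli \<theta>') I j" and I: "I \<in> rat_intervals"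
    unfolding seminorms_alt by blast
  show "\<exists>R d. finite R \<and> R \<subseteq> T_B_seminorms p \<theta> \<and> d > 0 \<and>
      (\<forall>g\<in>\<Union>E. (\<forall>\<rho>'\<in>R. \<rho>' (\<lambda>w. g w - f w) < d) \<longrightarrow> \<rho> (\<lambda>w. g w - f w) < e)"
  proof (intro exI conjI ballI impI)
    show "{sup_delay (path_norm p) \<theta> C_ball I j} \<subseteq> T_B_seminorms p \<theta>"
      using I unfolding seminorms_alt by blast
    fix g assume "g \<in> \<Union>E" and small: "\<forall>\<rho>'\<in>{sup_delay (path_norm p) \<theta> C_ball I j}. \<rho>' (\<lambda>w. g w - f w) < e"
    then have "g \<in> SC_fun p" using E SC_class(2)[OF p] by blast
    then have h: "(\<lambda>w. g w - f w) \<in> SC_fun p" using f by (intro SC_fun_diff)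
    have "\<rho> (\<lambda>w. g w - f w) \<le> sup_delay (path_norm p) \<theta> C_ball I j (\<lambda>w. g w - f w)"
      unfolding \<rho> sup_delay_def[of _ _ "C_moduli \<theta>'"]
    proof (rule cSUP_least)
      show "C_moduli \<theta> I j \<times> C_moduli \<theta>' (shift I) j \<noteq> {}"
        using C_moduli_nonempty[OF \<theta> I] C_moduli_delays(2)[OF \<theta>' I] by blast
      fix i :: "(real \<Rightarrow> real ^ 'n) \<times> (real \<Rightarrow> real ^ 'n)"
      assume "i \<in> C_moduli \<theta> I j \<times> C_moduli \<theta>' (shift I) j"
      then have "fst i \<in> C_moduli \<theta> I j" "snd i \<in> C_ball (shift I) j" by (auto simp: C_moduli_def)
      then show "path_norm p I (\<lambda>t. (fst i t, snd i (t - 1))) (\<lambda>w. g w - f w)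
          \<le> sup_delay (path_norm p) \<theta> C_ball I j (\<lambda>w. g w - f w)"
        by (rule sup_delay_upper[where U = C_ball,
              OF path_functional_path_norm[OF p] \<theta> I order_refl C_ball_nonempty h])
    qed
    also have "\<dots> < e" using small by blast
    finally show "\<rho> (\<lambda>w. g w - f w) < e" .
  qed (use e in simp_all)
qed (use p \<theta> \<theta>' adapted_T_moduli adapted_T_B seminorms_nonempty in blast)+

lemma T_B_weaker_T_D:
  fixes E :: "('n::finite) field set set"
  assumes p: "1 \<le> p" and E: "E \<subseteq> SC p" and \<theta>: "suitable_moduli \<theta>"
    and D: "closure D = UNIV" and bd: "bounded_l2_bounds p p E"
  shows "weaker_on E (T_B p \<theta>) (T_D p \<theta> D)"
  unfolding T_B_def T_D_def
proof (rule weaker_on_seminorm_topology[OF p E])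
  show "adapted p \<rho>" if "\<rho> \<in> T_B_seminorms p \<theta>" for \<rho> :: "'n field \<Rightarrow> real"
    by (rule adapted_T_B[OF p \<theta> that])
  show "adapted p \<rho>" if "\<rho> \<in> T_D_seminorms p \<theta> D" for \<rho>
    by (rule adapted_T_D[OF p \<theta> that])
  have "D \<noteq> {}" using D by auto
  then show "T_D_seminorms p \<theta> D \<noteq> {}" by (rule seminorms_nonempty)
  fix f :: "'n field" and \<rho> :: "'n field \<Rightarrow> real" and e :: real
  assume f: "f \<in> SC_fun p" and \<rho>B: "\<rho> \<in> T_B_seminorms p \<theta>" and e: "0 < e"
  obtain I j where \<rho>: "\<rho> = sup_delay (path_norm p) \<theta> C_ball I j" and I: "I \<in> rat_intervals"
    using \<rho>B unfolding seminorms_alt by blast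
  obtain a b where ab: "I = {a..b}" using I by (rule rat_intervalsE)
  \<comment> \<open>The bound is uniform in x and u. Since a supremum preserves only the non-strict
    inequality, e / 2 is requested to end strictly below e.\<close>
  obtain V d where V: "finite V" "V \<subseteq> D" "0 < d"
    and ctl: "\<And>g x u. g \<in> \<Union>E \<Longrightarrow> x \<in> C_ball {a..b} j \<Longrightarrow> u \<in> C_ball (shift {a..b}) j \<Longrightarrow>
      (\<And>v. v \<in> V \<Longrightarrow> path_norm p {a..b} (\<lambda>t. (x t, v)) (\<lambda>w. g w - f w) \<le> d) \<Longrightarrow>
      path_norm p {a..b} (\<lambda>t. (x t, u (t - 1))) (\<lambda>w. g w - f w) \<le> e / 2"
    by (rule path_norm_control[OF p E bd D f, where e = "e / 2" and a = a and b = b and j = j])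
      (use e in auto)
  show "\<exists>R d. finite R \<and> R \<subseteq> T_D_seminorms p \<theta> D \<and> d > 0 \<and>
      (\<forall>g\<in>\<Union>E. (\<forall>\<rho>'\<in>R. \<rho>' (\<lambda>w. g w - f w) < d) \<longrightarrow> \<rho> (\<lambda>w. g w - f w) < e)"
  proof (intro exI conjI ballI impI)
    show "finite ((\<lambda>v. sup_const (path_norm p) \<theta> I j v) ` V)" using V by simp
    show "(\<lambda>v. sup_const (path_norm p) \<theta> I j v) ` V \<subseteq> T_D_seminorms p \<theta> D"
      using I V(2) unfolding seminorms_alt by blast
    show "0 < d" by fact
    fix g assume g: "g \<in> \<Union>E"
      and small: "\<forall>\<rho>'\<in>(\<lambda>v. sup_const (path_norm p) \<theta> I j v) ` V. \<rho>' (\<lambda>w. g w - f w) < d"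
    then have "g \<in> SC_fun p" using E SC_class(2)[OF p] by blast
    then have h: "(\<lambda>w. g w - f w) \<in> SC_fun p" using f by (intro SC_fun_diff)
    have "\<rho> (\<lambda>w. g w - f w) \<le> e / 2"
      unfolding \<rho> sup_delay_def
    proof (rule cSUP_least)
      show "C_moduli \<theta> I j \<times> C_ball (shift I) j \<noteq> {}"
        using C_moduli_nonempty[OF \<theta> I] C_ball_nonempty by blast
      fix i :: "(real \<Rightarrow> real ^ 'n) \<times> (real \<Rightarrow> real ^ 'n)"
      assume "i \<in> C_moduli \<theta> I j \<times> C_ball (shift I) j"
      then have i: "fst i \<in> C_moduli \<theta> I j" "fst i \<in> C_ball I j" "snd i \<in> C_ball (shift I) j"
        by (auto simp: C_moduli_def)
      have "path_norm p I (\<lambda>t. (fst i t, v)) (\<lambda>w. g w - f w) \<le> d" if "v \<in> V" for v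
      proof -
        have "sup_const (path_norm p) \<theta> I j v (\<lambda>w. g w - f w) < d" using small that by blast
        with sup_const_upper[OF path_functional_path_norm[OF p] \<theta> I h i(1), of v]
        show ?thesis by linarith
      qed
      then show "path_norm p I (\<lambda>t. (fst i t, snd i (t - 1))) (\<lambda>w. g w - f w) \<le> e / 2"
        using ctl[OF g] i(2,3) unfolding ab by blast
    qed
    then show "\<rho> (\<lambda>w. g w - f w) < e" using e by linarith
  qed
qed

lemma sigma_moduli_weaker_sigma_D:
  fixes E :: "('n::finite) field set set"
  assumes E: "E \<subseteq> SC 1" and \<theta>: "suitable_moduli \<theta>" and \<theta>': "suitable_moduli \<theta>'"
    and D: "closure D = UNIV" and bd: "bounded_l2_bounds p 1 E"
  shows "weaker_on E (sigma_moduli \<theta> \<theta>') (sigma_D \<theta> D)"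
  unfolding sigma_moduli_def sigma_D_def
proof (rule weaker_on_seminorm_topology[OF order_refl E])
  show "adapted 1 \<rho>" if "\<rho> \<in> sigma_moduli_seminorms \<theta> \<theta>'" for \<rho> :: "'n field \<Rightarrow> real"
    by (rule adapted_sigma_moduli[OF \<theta> \<theta>' that])
  show "adapted 1 \<rho>" if "\<rho> \<in> sigma_D_seminorms \<theta> D" for \<rho>
    by (rule adapted_sigma_D[OF \<theta> that])
  have "D \<noteq> {}" using D by auto
  then show "sigma_D_seminorms \<theta> D \<noteq> {}" by (rule seminorms_nonempty)
  fix f :: "'n field" and \<rho> :: "'n field \<Rightarrow> real" and e :: real
  assume f: "f \<in> SC_fun 1" and \<rho>B: "\<rho> \<in> sigma_moduli_seminorms \<theta> \<theta>'" and e: "0 < e"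
  obtain I j where \<rho>: "\<rho> = sup_delay path_mean \<theta> (C_moduli \<theta>') I j" and I: "I \<in> rat_intervals"
    using \<rho>B unfolding seminorms_alt by blast
  obtain a b where ab: "I = {a..b}" and rat: "a \<in> \<rat>" "b \<in> \<rat>" "a \<le> b" using I by (rule rat_intervalsE)
  obtain V \<J> d where V: "finite V" "V \<subseteq> D" and \<J>: "finite \<J>" "\<J> \<subseteq> rat_intervals" and d: "0 < d"
    and ctl: "\<And>g x u. g \<in> \<Union>E \<Longrightarrow> x \<in> C_moduli \<theta> {a..b} j \<Longrightarrow> u \<in> C_moduli \<theta>' (shift {a..b}) j \<Longrightarrow>
      (\<And>v J y. v \<in> V \<Longrightarrow> J \<in> \<J> \<Longrightarrow> y \<in> C_moduli \<theta> J j \<Longrightarrow>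
         path_mean J (\<lambda>t. (y t, v)) (\<lambda>w. g w - f w) \<le> d) \<Longrightarrow>
      path_mean {a..b} (\<lambda>t. (x t, u (t - 1))) (\<lambda>w. g w - f w) \<le> e / 2"
    by (rule path_mean_control[OF E bd D f _ \<theta> \<theta>' rat, where e = "e / 2" and j = j])
      (use e in auto)
  \<comment> \<open>One seminorm for each pair of an interval and a net point. The index j is the
    same throughout, since freezing a path does not take it out of the ball of radius j.\<close>
  let ?R = "(\<lambda>(J, v). sup_const path_mean \<theta> J j v) ` (\<J> \<times> V)"
  show "\<exists>R d. finite R \<and> R \<subseteq> sigma_D_seminorms \<theta> D \<and> d > 0 \<and>
      (\<forall>g\<in>\<Union>E. (\<forall>\<rho>'\<in>R. \<rho>' (\<lambda>w. g w - f w) < d) \<longrightarrow> \<rho> (\<lambda>w. g w - f w) < e)"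
  proof (intro exI conjI ballI impI)
    show "finite ?R" using V \<J> by simp
    show "?R \<subseteq> sigma_D_seminorms \<theta> D"
      using \<J>(2) V(2) unfolding seminorms_alt by (clarsimp, blast)
    show "0 < d" by fact
    fix g assume g: "g \<in> \<Union>E" and small: "\<forall>\<rho>'\<in>?R. \<rho>' (\<lambda>w. g w - f w) < d"
    then have "g \<in> SC_fun 1" using E SC_class(2)[OF order_refl] by blast
    then have h: "(\<lambda>w. g w - f w) \<in> SC_fun 1" using f by (intro SC_fun_diff)
    have means: "path_mean J (\<lambda>t. (y t, v)) (\<lambda>w. g w - f w) \<le> d"
      if "v \<in> V" "J \<in> \<J>" "y \<in> C_moduli \<theta> J j" for v J y
    proof -
      have "sup_const path_mean \<theta> J j v \<in> ?R" using that(1,2) by force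
      then have "sup_const path_mean \<theta> J j v (\<lambda>w. g w - f w) < d" using small by blast
      moreover have "J \<in> rat_intervals" using that(2) \<J>(2) by blast
      ultimately show ?thesis
        using sup_const_upper[OF path_functional_path_mean \<theta> _ h that(3), of v] by linarith
    qed
    have "\<rho> (\<lambda>w. g w - f w) \<le> e / 2"
      unfolding \<rho> sup_delay_def
    proof (rule cSUP_least)
      show "C_moduli \<theta> I j \<times> C_moduli \<theta>' (shift I) j \<noteq> {}"
        using C_moduli_nonempty[OF \<theta> I] C_moduli_delays(2)[OF \<theta>' I] by blast
      fix i :: "(real \<Rightarrow> real ^ 'n) \<times> (real \<Rightarrow> real ^ 'n)"
      assume "i \<in> C_moduli \<theta> I j \<times> C_moduli \<theta>' (shift I) j"
      then have i: "fst i \<in> C_moduli \<theta> I j" "snd i \<in> C_moduli \<theta>' (shift I) j" by auto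
      show "path_mean I (\<lambda>t. (fst i t, snd i (t - 1))) (\<lambda>w. g w - f w) \<le> e / 2"
        unfolding ab by (rule ctl[OF g i[unfolded ab] means])
    qed
    then show "\<rho> (\<lambda>w. g w - f w) < e" using e by linarith
  qed
qed

theorem theorem2p21:
  fixes p :: nat
    and E :: "('n::finite) field set set"
    and \<theta> \<theta>' :: moduli
    and D :: "(real ^ 'n) set"
  assumes "p \<ge> 1"
    and "E \<subseteq> SC p"
    and "suitable_moduli \<theta>" and "suitable_moduli \<theta>'"
    and "countable D" and "closure D = UNIV"
  shows "(bounded_l2_bounds p p E \<longrightarrow>
            (\<forall>T1 \<in> {T_D p \<theta> D, T_moduli p \<theta> \<theta>', T_B p \<theta>}.
             \<forall>T2 \<in> {T_D p \<theta> D, T_moduli p \<theta> \<theta>', T_B p \<theta>}.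
               subtopology T1 E = subtopology T2 E \<and> T1 closure_of E = T2 closure_of E)) \<and>
         (bounded_l2_bounds p 1 E \<longrightarrow>
            (\<forall>T1 \<in> {sigma_D \<theta> D, sigma_moduli \<theta> \<theta>'}.
             \<forall>T2 \<in> {sigma_D \<theta> D, sigma_moduli \<theta> \<theta>'}.
               subtopology T1 E = subtopology T2 E \<and> T1 closure_of E = T2 closure_of E))"
proof (intro conjI impI)
  \<comment> \<open>The weak topologies live on \<open>SC 1\<close>; as every class is formed inside
    \<open>SC_fun 1\<close>, E is literally a subset of that space.\<close>
  have E1: "E \<subseteq> SC 1" using assms(2) SC_subset[OF assms(1)] by blast
  have D0: "D \<noteq> {}" using assms(6) by auto
  note ad = adapted_T_D[OF assms(1,3)] adapted_T_moduli[OF assms(1,3,4)] adapted_T_B[OF assms(1,3)]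
    adapted_sigma_D[OF assms(3)] adapted_sigma_moduli[OF assms(3,4)]
  have tops: "topspace (T_D p \<theta> D) = SC p" "topspace (T_moduli p \<theta> \<theta>') = (SC p :: 'n field set set)"
    "topspace (T_B p \<theta>) = (SC p :: 'n field set set)"
    unfolding T_D_def T_moduli_def T_B_def
    by (intro topspace_seminorm_topology assms(1) seminorms_nonempty D0 ad; assumption)+
  have tops': "topspace (sigma_D \<theta> D) = SC 1" "topspace (sigma_moduli \<theta> \<theta>') = (SC 1 :: 'n field set set)"
    unfolding sigma_D_def sigma_moduli_def
    by (intro topspace_seminorm_topology order_refl seminorms_nonempty D0 ad; assumption)+
  {
    assume bd: "bounded_l2_bounds p p E"
    \<comment> \<open>The three comparisons form a cycle, so transitivity makes any two of the
      topologies weaker than each other relative to E.\<close>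
    note DM = T_D_weaker_T_moduli[OF assms(1-4), of D]
    note MB = T_moduli_weaker_T_B[OF assms(1-4)]
    note BD = T_B_weaker_T_D[OF assms(1-3,6) bd]
    have 1: "subtopology (T_D p \<theta> D) E = subtopology (T_moduli p \<theta> \<theta>') E \<and>
        T_D p \<theta> D closure_of E = T_moduli p \<theta> \<theta>' closure_of E"
      by (rule weaker_on_antisym[OF DM weaker_on_trans[OF MB BD]]) (simp add: tops)
    have 2: "subtopology (T_moduli p \<theta> \<theta>') E = subtopology (T_B p \<theta>) E \<and>
        T_moduli p \<theta> \<theta>' closure_of E = T_B p \<theta> closure_of E"
      by (rule weaker_on_antisym[OF MB weaker_on_trans[OF BD DM]]) (simp add: tops)
    show "\<forall>T1 \<in> {T_D p \<theta> D, T_moduli p \<theta> \<theta>', T_B p \<theta>}. \<forall>T2 \<in> {T_D p \<theta> D, T_moduli p \<theta> \<theta>', T_B p \<theta>}.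
        subtopology T1 E = subtopology T2 E \<and> T1 closure_of E = T2 closure_of E"
      using 1 2 by simp
  next
    assume bd: "bounded_l2_bounds p 1 E"
    have "subtopology (sigma_D \<theta> D) E = subtopology (sigma_moduli \<theta> \<theta>') E \<and>
        sigma_D \<theta> D closure_of E = sigma_moduli \<theta> \<theta>' closure_of E"
      by (rule weaker_on_antisym[OF sigma_D_weaker_sigma_moduli[OF E1 assms(3,4)]
            sigma_moduli_weaker_sigma_D[OF E1 assms(3,4,6) bd]]) (simp add: tops')
    then show "\<forall>T1 \<in> {sigma_D \<theta> D, sigma_moduli \<theta> \<theta>'}. \<forall>T2 \<in> {sigma_D \<theta> D, sigma_moduli \<theta> \<theta>'}.
        subtopology T1 E = subtopology T2 E \<and> T1 closure_of E = T2 closure_of E"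
      by simp
  }
qed

end
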